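(* Let $\mathcal F=(F_1,F_2)$ be a pair of finite sets of positive integers and $\alpha,\beta$ real numbers satisfying (A1) and (A2). Assume $$\alpha+k+1>0,\qquad\beta+k_1-k_2+1>0,\qquad\Omega^{\alpha,\beta}_{\mathcal F}(x)\neq0\ \text{for all }x\in[-1,1].$$ Then $\alpha,\beta,\mathcal F$ are Jacobi admissible.
   Context: $(a)_0=1$, $(a)_j=a(a+1)\cdots(a+j-1)$. Jacobi polynomials: $P^{a,b}_n(x)=2^{-n}\sum_{j=0}^n\binom{n+a}{j}\binom{n+b}{n-j}(x-1)^{n-j}(x+1)^j$. A pair $\mathcal F=(F_1,F_2)$ consists of finite sets of positive integers, not both empty, $F_i=\{f^{(i)}_1<\dots<f^{(i)}_{k_i}\}$, $k=k_1+k_2$. (A1): $\alpha,\beta,\alpha+\beta\notin\{-1,-2,\dots\}$. (A2): if $F_2\ne\emptyset$, then $\alpha-\beta\notin\{-1,-2,\dots\}$ and $\beta-f^{(2)}_{k_2}-1\notin\{-1,-2,\dots\}$. $\Omega^{\alpha,\beta}_{\mathcal F}(x)=\det W(x)/(1+x)^{k_2(k_2-1)}$, with $W(x)$ the $k\times k$ matrix (columns $j=1..k$) with rows $((-1)^{j-1}(P^{\alpha,\beta}_f)^{(j-1)}(x))_j$ for $f\in F_1$ increasing, then $((\beta-f)_{j-1}(1+x)^{k-j}P^{\alpha+j-1,-\beta-j+1}_f(x))_j$ for $f\in F_2$ increasing. Jacobi admissibility: with $\mathcal H^{\alpha,\beta}_{\mathcal F}(x)=\prod_{f\in F_1}(x-f)(x+f+\alpha+\beta+1)\prod_{f\in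 F_2}(x+\beta-f)(x+f+\alpha+1)\cdot\frac{\Gamma(x+\alpha+1)\Gamma(x+\beta+1)}{(2x+\alpha+\beta+1)\Gamma(x+\alpha+\beta+1)}$, $\alpha,\beta,\mathcal F$ are Jacobi admissible if $\mathcal H^{\alpha,\beta}_{\mathcal F}(x)\ge0$ for all $x\in\mathbb N=\{0,1,2,\dots\}$. *)

theory Defs
  imports "HOL-Analysis.Gamma_Function" "HOL-Computational_Algebra.Polynomial"
    "Jordan_Normal_Form.Determinant"
begin

definition jacobi_poly :: "real \<Rightarrow> real \<Rightarrow> nat \<Rightarrow> real poly" where
  "jacobi_poly a b n = smult (1 / 2 ^ n)
     (\<Sum>j\<le>n. smult (((real n + a) gchoose j) * ((real n + b) gchoose (n - j)))
        ([:-1, 1:] ^ (n - j) * [:1, 1:] ^ j))"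

text \<open>The k x k matrix W (0-indexed rows i and columns j, so column j here is
  column j+1 of the paper): rows for F1 (increasing) then rows for F2 (increasing).\<close>
definition W_mat :: "real \<Rightarrow> real \<Rightarrow> nat set \<Rightarrow> nat set \<Rightarrow> real poly mat" where
  "W_mat a b F1 F2 =
    (let k1 = card F1; k2 = card F2; k = k1 + k2;
         L1 = sorted_list_of_set F1; L2 = sorted_list_of_set F2
     in Matrix.mat k k (\<lambda>(i, j).
          if i < k1 then
            smult ((-1) ^ j) ((pderiv ^^ j) (jacobi_poly a b (L1 ! i)))
          else
            (let f = L2 ! (i - k1) in
              smult (pochhammer (b - real f) j)
                ([:1, 1:] ^ (k - Suc j) * jacobi_poly (a + real j) (- b - real j) f))))"

definition Omega_poly :: "real \<Rightarrow> real \<Rightarrow> nat set \<Rightarrow> nat set \<Rightarrow> real poly" where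
  "Omega_poly a b F1 F2 =
     Determinant.det (W_mat a b F1 F2) div [:1, 1:] ^ (card F2 * (card F2 - 1))"

definition H_fun :: "real \<Rightarrow> real \<Rightarrow> nat set \<Rightarrow> nat set \<Rightarrow> real \<Rightarrow> real" where
  "H_fun a b F1 F2 x =
     (\<Prod>f\<in>F1. (x - real f) * (x + real f + a + b + 1)) *
     (\<Prod>f\<in>F2. (x + b - real f) * (x + real f + a + 1)) *
     (Gamma (x + a + 1) * Gamma (x + b + 1) /
       ((2 * x + a + b + 1) * Gamma (x + a + b + 1)))"

definition jacobi_admissible :: "real \<Rightarrow> real \<Rightarrow> nat set \<Rightarrow> nat set \<Rightarrow> bool" where
  "jacobi_admissible a b F1 F2 \<longleftrightarrow> (\<forall>x::nat. H_fun a b F1 F2 (real x) \<ge> 0)"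

definition not_neg_int :: "real \<Rightarrow> bool" where
  "not_neg_int y \<longleftrightarrow> (\<forall>n::nat. y \<noteq> - real (Suc n))"

end

theory Submission
  imports Defs "HOL-Computational_Algebra.Polynomial_Factorial"
    "HOL-Computational_Algebra.Field_as_Ring"
begin

text \<open>The seeds (the Jacobi polynomials for \<open>F1\<close> and the functions \<open>(1 + x)\<^sup>-\<^sup>\<beta> P\<close> for \<open>F2\<close>) are
  eigenfunctions of the Jacobi operator, and \<open>\<Omega>\<close> is their Wronskian up to powers of \<open>1 + x\<close>. The
  Darboux-Crum operator \<open>D\<close> with these seeds is a product of first-order factors, and integrating by
  parts one factor at a time shows that \<open>(1 - x\<^sup>2)\<^sup>k (D P\<^sub>n)\<^sup>2\<close> and \<open>(\<Prod>\<^sub>i (\<theta>\<^sub>n - \<theta>\<^sub>i)) P\<^sub>n\<^sup>2\<close> differ by a total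
  derivative against the weight \<open>(1 - x)\<^sup>\<alpha> (1 + x)\<^sup>\<beta>\<close>, although the single factors may be singular inside
  the interval. The square \<open>P\<^sub>n\<^sup>2\<close> is in turn congruent to a multiple of \<open>(1 - x\<^sup>2)\<^sup>M\<close>, and the resulting
  constant is \<open>H(n)\<close> up to a positive factor. For non-integer \<open>\<alpha>\<close> and \<open>\<beta>\<close> the antiderivative
  vanishes at both ends of \<open>[-1, 1]\<close> as soon as \<open>\<Omega>\<close> has no zero there, so by Rolle's theorem the nonnegative
  function \<open>(1 - x\<^sup>2)\<^sup>k (D P\<^sub>n)\<^sup>2\<close> equals that multiple of \<open>(1 - x\<^sup>2)\<^sup>M\<close> at some point, whence \<open>H(n) \<ge> 0\<close>.
  Integer parameters are reached by letting \<open>(\<alpha> + \<epsilon>, \<beta> + \<epsilon>)\<close> tend to \<open>(\<alpha>, \<beta>)\<close>.\<close>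

subsection \<open>Darboux transformations in a differential field\<close>

locale diff_field =
  fixes d :: "'a::field_char_0 \<Rightarrow> 'a"
  assumes d_add: "d (x + y) = d x + d y"
    and d_mult: "d (x * y) = d x * y + x * d y"
begin

lemma d_0 [simp]: "d 0 = 0"
  using d_add[of 0 0] by (metis add_cancel_right_right add_0)

lemma d_1 [simp]: "d 1 = 0"
  using d_mult[of 1 1] by (metis add_cancel_right_right mult_1 mult_1_right)

lemma d_uminus [simp]: "d (- x) = - d x"
  using d_add[of x "- x"] by (simp add: eq_neg_iff_add_eq_0 add.commute)

lemma d_diff: "d (x - y) = d x - d y"
  using d_add[of x "- y"] by simp

lemma d_power: "d (x ^ n) = of_nat n * x ^ (n - 1) * d x"
proof (induction n)
  case (Suc n)
  then show ?case by (cases n) (auto simp: d_mult algebra_simps)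
qed simp

text \<open>An element \<open>v\<close> twisted by \<open>c\<close> stands for the formal product \<open>e v\<close>, where
  \<open>e\<close> has logarithmic derivative \<open>c\<close>; thus \<open>(1 + x)\<^sup>b v\<close> is handled inside the field of rational
  functions with \<open>c = b / (1 + x)\<close>.\<close>

definition tw :: "'a \<Rightarrow> 'a \<Rightarrow> 'a" where
  "tw c v = d v + c * v"

lemma tw_0_left [simp]: "tw 0 v = d v"
  by (simp add: tw_def)

lemma tw_0 [simp]: "tw c 0 = 0"
  by (simp add: tw_def)

lemma tw_add: "tw c (u + v) = tw c u + tw c v"
  by (simp add: tw_def d_add algebra_simps)

lemma tw_mult: "tw c (u * v) = d u * v + u * tw c v"
  by (simp add: tw_def d_mult algebra_simps)

lemma tw_sum: "tw c (sum f A) = (\<Sum>i\<in>A. tw c (f i))"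
  by (induction A rule: infinite_finite_induct) (auto simp: tw_add)

text \<open>\<open>dop [\<sigma>\<^sub>j, \<dots>, \<sigma>\<^sub>0]\<close> is the operator \<open>(\<partial> - \<sigma>\<^sub>j) \<dots> (\<partial> - \<sigma>\<^sub>0)\<close>.\<close>

primrec dop :: "'a list \<Rightarrow> 'a \<Rightarrow> 'a \<Rightarrow> 'a" where
  "dop [] c v = v"
| "dop (s # ss) c v = tw c (dop ss c v) - s * dop ss c v"

primrec dop_coeff :: "'a list \<Rightarrow> nat \<Rightarrow> 'a" where
  "dop_coeff [] l = (if l = 0 then 1 else 0)"
| "dop_coeff (s # ss) l = d (dop_coeff ss l) + (case l of 0 \<Rightarrow> 0 | Suc m \<Rightarrow> dop_coeff ss m)
     - s * dop_coeff ss l"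

lemma dop_coeff_high: "l > length ss \<Longrightarrow> dop_coeff ss l = 0"
  by (induction ss arbitrary: l) (auto split: nat.splits)

lemma dop_coeff_length: "dop_coeff ss (length ss) = 1"
  by (induction ss) (auto simp: dop_coeff_high)

text \<open>By \<open>tw_mult\<close> only \<open>d\<close> falls on the coefficients, so they do
  not involve the twist \<open>c\<close>. One coefficient list thus serves all rows of a Wronskian
  matrix, whatever their twists.\<close>

lemma dop_expand:
  assumes "length ss < K"
  shows "dop ss c v = (\<Sum>l<K. dop_coeff ss l * (tw c ^^ l) v)"
  using assms
proof (induction ss arbitrary: K)
  case Nil
  have "(\<Sum>l<K. (if l = 0 then 1 else 0) * (tw c ^^ l) v) = (\<Sum>l\<in>{0}. (tw c ^^ l) v)"
    using Nil by (intro sum.mono_neutral_cong_right) auto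
  then show ?case by simp
next
  case (Cons s ss)
  then obtain K' where K: "K = Suc K'" by (cases K) auto
  have e: "dop ss c v = (\<Sum>l<K. dop_coeff ss l * (tw c ^^ l) v)"
    using Cons by simp
  have e': "dop ss c v = (\<Sum>l<K'. dop_coeff ss l * (tw c ^^ l) v)"
    using Cons K by simp
  have "tw c (dop ss c v) = (\<Sum>l<K'. d (dop_coeff ss l) * (tw c ^^ l) v)
      + (\<Sum>l<K'. dop_coeff ss l * (tw c ^^ Suc l) v)"
    unfolding e' by (simp add: tw_sum tw_mult sum.distrib)
  also have "(\<Sum>l<K'. dop_coeff ss l * (tw c ^^ Suc l) v)
      = (\<Sum>l<K. (case l of 0 \<Rightarrow> 0 | Suc m \<Rightarrow> dop_coeff ss m) * (tw c ^^ l) v)"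
    unfolding K sum.lessThan_Suc_shift by simp
  also have "(\<Sum>l<K'. d (dop_coeff ss l) * (tw c ^^ l) v)
      = (\<Sum>l<K. d (dop_coeff ss l) * (tw c ^^ l) v)"
    using Cons.prems unfolding K by (simp add: dop_coeff_high)
  finally show ?case
    by (simp add: e sum_subtractf sum.distrib sum_distrib_left algebra_simps)
qed

text \<open>Each new head is the logarithmic derivative of the next seed after the factors chosen so
  far, so that the enlarged operator annihilates this seed too.\<close>

primrec sigs :: "(nat \<Rightarrow> 'a) \<Rightarrow> (nat \<Rightarrow> 'a) \<Rightarrow> nat \<Rightarrow> 'a list" where
  "sigs c v 0 = []"
| "sigs c v (Suc j) =
     tw (c j) (dop (sigs c v j) (c j) (v j)) / dop (sigs c v j) (c j) (v j) # sigs c v j"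

lemma length_sigs [simp]: "length (sigs c v j) = j"
  by (induction j) auto

text \<open>The factor added at step \<open>i\<close> kills seed \<open>i\<close>, and every later
  factor maps 0 to 0.\<close>

lemma dop_sigs_eq_0:
  assumes "i < j"
  shows "dop (sigs c v j) (c i) (v i) = 0"
  using assms
proof (induction j)
  case (Suc j)
  show ?case
  proof (cases "i = j")
    case True
    then show ?thesis by (cases "dop (sigs c v j) (c j) (v j) = 0") auto
  next
    case False
    then show ?thesis using Suc by simp
  qed
qed simp

text \<open>Row \<open>i\<close> is the Wronskian row of a formal product \<open>e v\<close> with
  its prefactor \<open>e\<close> cancelled; different rows may have different prefactors.\<close>

definition wr_mat :: "(nat \<Rightarrow> 'a) \<Rightarrow> (nat \<Rightarrow> 'a) \<Rightarrow> nat \<Rightarrow> 'a mat" where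
  "wr_mat c v K = Matrix.mat K K (\<lambda>(i, j). (tw (c i) ^^ j) (v i))"

text \<open>A unitriangular change of columns turns the Wronskian matrix into a lower triangular one. The
  identity persists when some factor vanishes, because of the convention \<open>x / 0 = 0\<close> in
  \<^const>\<open>sigs\<close>.\<close>

lemma det_wr_mat:
  "Determinant.det (wr_mat c v K) = (\<Prod>i<K. dop (sigs c v i) (c i) (v i))"
proof -
  let ?W = "wr_mat c v K"
  define U where "U = Matrix.mat K K (\<lambda>(l, j). dop_coeff (sigs c v j) l)"
  define L where "L = Matrix.mat K K (\<lambda>(i, j). dop (sigs c v j) (c i) (v i))"
  have W: "?W \<in> carrier_mat K K" by (simp add: wr_mat_def)
  have U: "U \<in> carrier_mat K K" by (simp add: U_def)
  have L: "L \<in> carrier_mat K K" by (simp add: L_def)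
  have "?W * U = L"
  proof (rule eq_matI)
    fix i j assume "i < dim_row L" "j < dim_col L"
    then have ij: "i < K" "j < K" by (auto simp: L_def)
    have "(?W * U) $$ (i, j) = (\<Sum>l<K. (tw (c i) ^^ l) (v i) * dop_coeff (sigs c v j) l)"
      using ij by (simp add: wr_mat_def U_def scalar_prod_def lessThan_atLeast0)
    also have "\<dots> = dop (sigs c v j) (c i) (v i)"
      using ij by (subst dop_expand[of _ K]) (auto simp: mult.commute)
    finally show "(?W * U) $$ (i, j) = L $$ (i, j)"
      using ij by (simp add: L_def)
  qed (auto simp: wr_mat_def U_def L_def)
  then have "Determinant.det ?W * Determinant.det U = Determinant.det L"
    using det_mult[OF W U] by simp
  moreover have "Determinant.det U = 1"
  proof -
    have "upper_triangular U"
      by (auto simp: upper_triangular_def U_def dop_coeff_high)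
    moreover have "diag_mat U = replicate K 1"
      using dop_coeff_length[of "sigs c v _"]
      by (auto simp: diag_mat_def U_def intro!: nth_equalityI)
    ultimately show ?thesis
      using det_upper_triangular[OF _ U] by simp
  qed
  moreover have "Determinant.det L = (\<Prod>i<K. dop (sigs c v i) (c i) (v i))"
  proof -
    have "Determinant.det L = prod_list (diag_mat L)"
      by (rule det_lower_triangular[OF _ L]) (auto simp: L_def dop_sigs_eq_0)
    also have "diag_mat L = map (\<lambda>i. dop (sigs c v i) (c i) (v i)) [0..<K]"
      by (auto simp: diag_mat_def L_def)
    also have "prod_list \<dots> = (\<Prod>i<K. dop (sigs c v i) (c i) (v i))"
      by (simp add: prod.distinct_set_conv_list[symmetric] lessThan_atLeast0)
    finally show ?thesis .
  qed
  ultimately show ?thesis by simp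
qed

text \<open>Crum's formula without division: appending a function to the \<open>K\<close> seeds
  multiplies the Wronskian by the Darboux-Crum operator applied to that function.\<close>

lemma det_wr_mat_Suc:
  "Determinant.det (wr_mat c v (Suc K)) =
     Determinant.det (wr_mat c v K) * dop (sigs c v K) (c K) (v K)"
  by (simp add: det_wr_mat)

text \<open>The equation \<open>p f'' + r f' + s f = - \<theta> f\<close> for the formal product
  \<open>f = e v\<close>, with \<open>e\<close> cancelled.\<close>

definition eigenfun :: "'a \<Rightarrow> 'a \<Rightarrow> 'a \<Rightarrow> 'a \<Rightarrow> 'a \<Rightarrow> 'a \<Rightarrow> bool" where
  "eigenfun p r s c v \<theta> \<longleftrightarrow> p * tw c (tw c v) + r * tw c v + s * v + \<theta> * v = 0"

text \<open>One Darboux step: dividing out the seed with logarithmic derivative \<open>\<sigma>\<close>, which satisfies the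
  Riccati equation, adds \<open>p'\<close> to the first-order coefficient.\<close>

lemma darboux_eigenfun:
  assumes ric: "p * (d \<sigma> + \<sigma> * \<sigma>) + r * \<sigma> + s + \<mu> = 0"
    and eig: "eigenfun p r s c v \<theta>"
    and const: "d \<mu> = 0" "d \<theta> = 0"
  shows "eigenfun p (r + d p) (d (r + p * \<sigma>) - \<sigma> * (r + p * \<sigma>) - \<mu>) c (tw c v - \<sigma> * v) \<theta>"
proof -
  define w where "w = tw c v - \<sigma> * v"
  define q where "q = r + p * \<sigma>"
  have tv: "tw c v = w + \<sigma> * v" by (simp add: w_def)
  have ttv: "tw c (tw c v) = tw c w + d \<sigma> * v + \<sigma> * (w + \<sigma> * v)"
    by (subst tv, simp add: tw_add tw_mult tv)
  \<comment> \<open>Subtracting \<open>v\<close> times the Riccati equation eliminates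
    \<open>s\<close> and leaves a first-order relation between \<open>w\<close> and
    \<open>v\<close>.\<close>
  have "p * tw c w + q * w + (\<theta> - \<mu>) * v
      = (p * tw c (tw c v) + r * tw c v + s * v + \<theta> * v)
        - (p * (d \<sigma> + \<sigma> * \<sigma>) + r * \<sigma> + s + \<mu>) * v"
    unfolding ttv unfolding q_def tv by (simp add: algebra_simps)
  then have eq: "p * tw c w + q * w + (\<theta> - \<mu>) * v = 0"
    using eig ric by (simp add: eigenfun_def)
  have "tw c (p * tw c w + q * w + (\<theta> - \<mu>) * v) =
      d p * tw c w + p * tw c (tw c w) + d q * w + q * tw c w + (\<theta> - \<mu>) * (w + \<sigma> * v)"
    by (simp add: tw_add tw_mult d_diff const tv)
  \<comment> \<open>Applying \<open>tw c\<close> minus \<sigma> to the relation turns its last term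
    into a multiple of \<open>w\<close>, which eliminates \<open>v\<close>.\<close>
  then have "p * tw c (tw c w) + (q + d p - \<sigma> * p) * tw c w + (d q - \<sigma> * q - \<mu>) * w + \<theta> * w
      = tw c (p * tw c w + q * w + (\<theta> - \<mu>) * v)
        - \<sigma> * (p * tw c w + q * w + (\<theta> - \<mu>) * v)"
    by (simp add: algebra_simps)
  also have "\<dots> = 0" unfolding eq by simp
  finally show ?thesis
    by (simp add: eigenfun_def w_def q_def algebra_simps)
qed

text \<open>For \<open>f = e x\<close> one has \<open>f' / f = \<sigma>\<close> and
  \<open>f'' / f = d \<sigma> + \<sigma> * \<sigma>\<close>, so the eigenvalue equation can be
  divided by \<open>x\<close>.\<close>

lemma riccati:
  assumes "eigenfun p r s c x \<mu>" "x \<noteq> 0" "\<sigma> = tw c x / x"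
  shows "p * (d \<sigma> + \<sigma> * \<sigma>) + r * \<sigma> + s + \<mu> = 0"
proof -
  have t: "tw c x = \<sigma> * x" using assms by simp
  have tt: "tw c (tw c x) = (d \<sigma> + \<sigma> * \<sigma>) * x"
    by (simp add: t tw_mult algebra_simps)
  have "(p * (d \<sigma> + \<sigma> * \<sigma>) + r * \<sigma> + s + \<mu>) * x = 0"
    using assms(1) unfolding eigenfun_def tt unfolding t by (simp add: algebra_simps)
  then show ?thesis using assms(2) by simp
qed

text \<open>With \<open>\<omega>\<close> the logarithmic derivative of a weight, two elements congruent modulo
  \<^term>\<open>exact \<omega>\<close> have formally the same integral against that weight.\<close>

definition exact :: "'a \<Rightarrow> 'a \<Rightarrow> bool" where
  "exact \<omega> g \<longleftrightarrow> (\<exists>R. g = d R + \<omega> * R)"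

lemma exact_0 [simp]: "exact \<omega> 0"
  unfolding exact_def by (rule exI[of _ 0]) simp

lemma exact_add: "exact \<omega> g \<Longrightarrow> exact \<omega> h \<Longrightarrow> exact \<omega> (g + h)"
proof -
  assume "exact \<omega> g" "exact \<omega> h"
  then obtain R S where "g = d R + \<omega> * R" "h = d S + \<omega> * S" by (auto simp: exact_def)
  then have "g + h = d (R + S) + \<omega> * (R + S)" by (simp add: d_add algebra_simps)
  then show "exact \<omega> (g + h)" unfolding exact_def by (rule exI)
qed

lemma exact_cmult:
  assumes "d k = 0" "exact \<omega> g"
  shows "exact \<omega> (k * g)"
proof -
  obtain R where "g = d R + \<omega> * R" using assms by (auto simp: exact_def)
  then have "k * g = d (k * R) + \<omega> * (k * R)"
    using assms by (simp add: d_mult algebra_simps)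
  then show ?thesis by (auto simp: exact_def)
qed

text \<open>Integration by parts, for the weight multiplied by \<open>p\<^sup>j\<close>.\<close>

lemma darboux_norm_step:
  assumes ric: "p * (d \<sigma> + \<sigma> * \<sigma>) + r * \<sigma> + s + \<mu> = 0"
    and eig: "eigenfun p r s 0 v \<theta>"
    and r: "r = d p + p * \<omega> + of_nat j * d p"
  shows "exact \<omega> (p ^ Suc j * (d v - \<sigma> * v)\<^sup>2 - (\<theta> - \<mu>) * (p ^ j * v\<^sup>2))"
proof -
  define w where "w = d v - \<sigma> * v"
  have dv: "d v = w + \<sigma> * v" by (simp add: w_def)
  have ddv: "d (d v) = d w + d \<sigma> * v + \<sigma> * (w + \<sigma> * v)"
    by (subst dv, simp add: d_add d_mult dv)
  have "p * d w + (r + p * \<sigma>) * w + (\<theta> - \<mu>) * v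
      = (p * d (d v) + r * d v + s * v + \<theta> * v)
        - (p * (d \<sigma> + \<sigma> * \<sigma>) + r * \<sigma> + s + \<mu>) * v"
    unfolding ddv unfolding dv by (simp add: algebra_simps)
  then have "p * d w + (r + p * \<sigma>) * w + (\<theta> - \<mu>) * v = 0"
    using eig ric by (simp add: eigenfun_def)
  then have eq: "p * d w = - (\<theta> - \<mu>) * v - (r + p * \<sigma>) * w"
    by (simp add: add_eq_0_iff algebra_simps)
  have dp: "d (p ^ Suc j) = p ^ j * (d p + of_nat j * d p)"
    by (subst d_power) (simp add: algebra_simps)
  \<comment> \<open>The antiderivative is \<open>p ^ Suc j * (v * w)\<close>; the form of
    \<open>r\<close> makes its derivative contain the left side of the relation
    \<open>eq\<close>.\<close>
  have "d (p ^ Suc j * (v * w)) + \<omega> * (p ^ Suc j * (v * w))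
      = p ^ j * (v * (p * d w + (r + p * \<sigma>) * w) + p * w * w)"
    unfolding d_mult[of "p ^ Suc j"] dp d_mult[of v] dv r by (simp add: algebra_simps)
  also have "\<dots> = p ^ Suc j * w\<^sup>2 - (\<theta> - \<mu>) * (p ^ j * v\<^sup>2)"
    unfolding eq by (simp add: algebra_simps power2_eq_square)
  finally show ?thesis
    unfolding exact_def w_def by (intro exI) (rule sym)
qed

text \<open>Iterated integration by parts: each seed contributes one factor
  \<open>\<theta> - \<mu> i\<close>.\<close>

lemma crum_norm:
  assumes r: "r = d p + p * \<omega>"
    and eig: "\<And>i. i < K \<Longrightarrow> eigenfun p r 0 (c i) (v i) (\<mu> i)"
    and const: "\<And>i. i < K \<Longrightarrow> d (\<mu> i) = 0" "d \<theta> = 0"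
    and nz: "\<And>i. i < K \<Longrightarrow> dop (sigs c v i) (c i) (v i) \<noteq> 0"
    and u: "eigenfun p r 0 0 u \<theta>"
  shows "exact \<omega> (p ^ K * (dop (sigs c v K) 0 u)\<^sup>2 - (\<Prod>i<K. \<theta> - \<mu> i) * u\<^sup>2)"
proof -
  \<comment> \<open>The coefficient \<open>s\<close> changes at every step. Only its existence
    matters, but a single \<open>s\<close> must serve all twists and eigenvalues, so that it applies
    to the next seed and to \<open>u\<close> alike.\<close>
  have "j \<le> K \<Longrightarrow> \<exists>s. (\<forall>c' v' \<theta>'. eigenfun p r 0 c' v' \<theta>' \<longrightarrow> d \<theta>' = 0 \<longrightarrow>
            eigenfun p (r + of_nat j * d p) s c' (dop (sigs c v j) c' v') \<theta>')
     \<and> exact \<omega> (p ^ j * (dop (sigs c v j) 0 u)\<^sup>2 - (\<Prod>i<j. \<theta> - \<mu> i) * u\<^sup>2)" for j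
  proof (induction j)
    case 0
    show ?case by (intro exI[of _ 0]) simp
  next
    case (Suc j)
    then obtain s where s: "\<And>c' v' \<theta>'. eigenfun p r 0 c' v' \<theta>' \<Longrightarrow> d \<theta>' = 0 \<Longrightarrow>
            eigenfun p (r + of_nat j * d p) s c' (dop (sigs c v j) c' v') \<theta>'"
      and ex: "exact \<omega> (p ^ j * (dop (sigs c v j) 0 u)\<^sup>2 - (\<Prod>i<j. \<theta> - \<mu> i) * u\<^sup>2)"
      by auto
    define x where "x = dop (sigs c v j) (c j) (v j)"
    define \<sigma> where "\<sigma> = tw (c j) x / x"
    have j: "j < K" using Suc by simp
    have ric: "p * (d \<sigma> + \<sigma> * \<sigma>) + (r + of_nat j * d p) * \<sigma> + s + \<mu> j = 0"
      by (rule riccati[OF _ _ \<sigma>_def]) (use s[OF eig const(1)] nz j in \<open>auto simp: x_def\<close>)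
    have D: "dop (sigs c v (Suc j)) c' v' =
        tw c' (dop (sigs c v j) c' v') - \<sigma> * dop (sigs c v j) c' v'" for c' v'
      by (simp add: \<sigma>_def x_def)
    have r': "r + of_nat j * d p + d p = r + of_nat (Suc j) * d p"
      by (simp add: algebra_simps)
    have ev: "eigenfun p (r + of_nat (Suc j) * d p)
        (d (r + of_nat j * d p + p * \<sigma>) - \<sigma> * (r + of_nat j * d p + p * \<sigma>) - \<mu> j)
        c' (dop (sigs c v (Suc j)) c' v') \<theta>'"
      if "eigenfun p r 0 c' v' \<theta>'" "d \<theta>' = 0" for c' v' \<theta>'
      using darboux_eigenfun[OF ric s[OF that]] that const j unfolding D r' by simp
    define y where "y = dop (sigs c v j) 0 u"
    define C where "C = (\<Prod>i<j. \<theta> - \<mu> i)"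
    have 1: "exact \<omega> (p ^ Suc j * (d y - \<sigma> * y)\<^sup>2 - (\<theta> - \<mu> j) * (p ^ j * y\<^sup>2))"
      unfolding y_def by (rule darboux_norm_step[OF ric s[OF u const(2)]]) (simp add: r)
    have 2: "exact \<omega> ((\<theta> - \<mu> j) * (p ^ j * y\<^sup>2 - C * u\<^sup>2))"
      unfolding y_def C_def by (rule exact_cmult[OF _ ex]) (use const j in \<open>simp add: d_diff\<close>)
    have "exact \<omega> (p ^ Suc j * (d y - \<sigma> * y)\<^sup>2 - C * (\<theta> - \<mu> j) * u\<^sup>2)"
      using exact_add[OF 1 2] by (simp add: algebra_simps)
    moreover have "dop (sigs c v (Suc j)) 0 u = d y - \<sigma> * y"
      unfolding D y_def by simp
    ultimately have "exact \<omega> (p ^ Suc j * (dop (sigs c v (Suc j)) 0 u)\<^sup>2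
          - (\<Prod>i<Suc j. \<theta> - \<mu> i) * u\<^sup>2)"
      by (simp only: C_def prod.lessThan_Suc)
    then show ?case
      using ev by blast
  qed
  from this[of K] show ?thesis by auto
qed

end

subsection \<open>Rational functions as a differential field\<close>

definition fract_deriv :: "real poly fract \<Rightarrow> real poly fract" where
  "fract_deriv x = (case quot_of_fract x of (a, b) \<Rightarrow>
     to_fract (pderiv a * b - a * pderiv b) / to_fract (b * b))"

text \<open>The quotient rule may be used with any representation, not only the normalised one;
  differentiating the cross-multiplied equation accounts for the difference.\<close>

lemma fract_deriv_divide:
  assumes "b \<noteq> 0"
  shows "fract_deriv (to_fract a / to_fract b) =
    to_fract (pderiv a * b - a * pderiv b) / to_fract (b * b)"
proof -
  obtain a' b' where q: "quot_of_fract (to_fract a / to_fract b) = (a', b')"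
    by (cases "quot_of_fract (to_fract a / to_fract b)")
  have b': "b' \<noteq> 0"
    using snd_quot_of_fract_nonzero[of "to_fract a / to_fract b"] q by simp
  have "to_fract a / to_fract b = to_fract a' / to_fract b'"
    using quot_to_fract_quot_of_fract[of "to_fract a / to_fract b"] q
    by (simp add: quot_to_fract_def Fract_conv_to_fract)
  then have "to_fract (a * b') = to_fract (a' * b)"
    using b' assms by (simp add: field_simps)
  then have e: "a * b' = a' * b" by (simp only: to_fract_eq_iff)
  have "pderiv (a * b') = pderiv (a' * b)" using e by simp
  then have e2: "pderiv a * b' + a * pderiv b' = pderiv a' * b + a' * pderiv b"
    by (simp add: pderiv_mult algebra_simps)
  have "(pderiv a' * b' - a' * pderiv b') * (b * b) - (pderiv a * b - a * pderiv b) * (b' * b')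
     = b * b' * ((pderiv a' * b + a' * pderiv b) - (pderiv a * b' + a * pderiv b'))
       + (a * b' - a' * b) * (b' * pderiv b + b * pderiv b')"
    by (simp add: algebra_simps)
  also have "\<dots> = 0" by (simp add: e e2)
  finally have "(pderiv a' * b' - a' * pderiv b') * (b * b) = (pderiv a * b - a * pderiv b) * (b' * b')"
    by simp
  then have "to_fract ((pderiv a' * b' - a' * pderiv b') * (b * b))
      = to_fract ((pderiv a * b - a * pderiv b) * (b' * b'))"
    by simp
  then have "to_fract (pderiv a' * b' - a' * pderiv b') * to_fract (b * b)
      = to_fract (pderiv a * b - a * pderiv b) * to_fract (b' * b')"
    by (simp only: to_fract_mult)
  moreover have "to_fract (b * b) \<noteq> 0" "to_fract (b' * b') \<noteq> 0"
    using b' assms by simp_all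
  ultimately show ?thesis
    unfolding fract_deriv_def q prod.case by (metis frac_eq_eq)
qed

lemma fract_deriv_to_fract [simp]: "fract_deriv (to_fract a) = to_fract (pderiv a)"
  using fract_deriv_divide[of 1 a] by simp

lemma fract_cases:
  fixes x :: "real poly fract"
  obtains a b where "x = to_fract a / to_fract b" "b \<noteq> 0" "coprime a b"
proof -
  obtain a b where q: "quot_of_fract x = (a, b)" by (cases "quot_of_fract x")
  have "x = to_fract a / to_fract b"
    using quot_to_fract_quot_of_fract[of x] q
    by (simp add: quot_to_fract_def Fract_conv_to_fract)
  moreover have "b \<noteq> 0" using snd_quot_of_fract_nonzero[of x] q by simp
  moreover have "coprime a b" using coprime_quot_of_fract[of x] q by simp
  ultimately show ?thesis using that by blast
qed

lemma diff_field_fract: "diff_field fract_deriv"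
proof
  fix x y :: "real poly fract"
  obtain a b where x: "x = to_fract a / to_fract b" "b \<noteq> 0" by (rule fract_cases)
  obtain a' b' where y: "y = to_fract a' / to_fract b'" "b' \<noteq> 0" by (rule fract_cases)
  have s: "x + y = to_fract (a * b' + a' * b) / to_fract (b * b')"
    using x y by (simp add: field_simps)
  have m: "x * y = to_fract (a * a') / to_fract (b * b')"
    unfolding x y by simp
  have nz: "to_fract b \<noteq> 0" "to_fract b' \<noteq> 0" "b * b' \<noteq> 0" using x y by auto
  show "fract_deriv (x + y) = fract_deriv x + fract_deriv y"
    unfolding s fract_deriv_divide[OF nz(3)] unfolding x(1) y(1)
      fract_deriv_divide[OF x(2)] fract_deriv_divide[OF y(2)]
    using nz(1,2) by (simp add: pderiv_mult pderiv_add divide_simps) (simp add: algebra_simps)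
  show "fract_deriv (x * y) = fract_deriv x * y + x * fract_deriv y"
    unfolding m fract_deriv_divide[OF nz(3)] unfolding x(1) y(1)
      fract_deriv_divide[OF x(2)] fract_deriv_divide[OF y(2)]
    using nz(1,2) by (simp add: pderiv_mult pderiv_add divide_simps) (simp add: algebra_simps)
qed

interpretation fd: diff_field fract_deriv
  by (rule diff_field_fract)

abbreviation "Y \<equiv> [:1, 1:] :: real poly"
abbreviation "Z \<equiv> [:1, -1:] :: real poly"

definition cst :: "real \<Rightarrow> real poly fract" where
  "cst r = to_fract [:r:]"

lemma cst_simps [simp]:
  "cst 0 = 0" "cst 1 = 1" "fract_deriv (cst r) = 0"
  by (simp_all add: cst_def pderiv_pCons flip: one_pCons)

lemma cst_add: "cst (r + s) = cst r + cst s"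
  and cst_diff: "cst (r - s) = cst r - cst s"
  and cst_mult: "cst (r * s) = cst r * cst s"
  and cst_minus: "cst (- r) = - cst r"
  by (simp_all add: cst_def flip: to_fract_add to_fract_diff to_fract_mult to_fract_uminus)

lemma cst_of_nat: "cst (of_nat n) = of_nat n"
  by (induction n) (simp_all add: cst_add)

lemma cst_numeral: "cst (numeral n) = numeral n"
  using cst_of_nat[of "numeral n"] by simp

lemma cst_prod: "cst (prod f A) = (\<Prod>i\<in>A. cst (f i))"
  by (induction A rule: infinite_finite_induct) (auto simp: cst_mult)

lemma cst_eq_0_iff [simp]: "cst r = 0 \<longleftrightarrow> r = 0"
  by (simp add: cst_def)

lemma cst_divide: "cst (r / s) = cst r / cst s"
proof (cases "s = 0")
  case False
  then have "cst (r / s) * cst s = cst r" by (simp flip: cst_mult)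
  with False show ?thesis by (simp add: field_simps)
qed simp

lemma to_fract_smult: "to_fract (smult r p) = cst r * to_fract p"
  by (simp add: cst_def flip: to_fract_mult)

lemma to_fract_power: "to_fract (p ^ n) = to_fract p ^ n"
  by (induction n) simp_all

lemma pderiv_Y [simp]: "pderiv Y = 1" and pderiv_Z [simp]: "pderiv Z = -1"
  by (simp_all add: pderiv_pCons one_pCons)

subsection \<open>Jacobi polynomials expanded at -1\<close>

text \<open>The coefficient of \<open>(1 + x)^m\<close> in the Jacobi polynomial of degree
  \<open>n\<close>; being 0 for \<open>m > n\<close>, it allows sums up to any common bound.\<close>

definition jc :: "real \<Rightarrow> real \<Rightarrow> nat \<Rightarrow> nat \<Rightarrow> real" where
  "jc a b n m = (if m \<le> n then (-1) ^ (n - m) / 2 ^ m * ((real n + b) gchoose (n - m))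
     * ((real n + a + b + real m) gchoose m) else 0)"

lemma smult_sum_right: "smult c (sum f A) = (\<Sum>i\<in>A. smult c (f i))"
  by (induction A rule: infinite_finite_induct) (auto simp: smult_add_right)

text \<open>The sum arises from \<open>x - 1 = (1 + x) - 2\<close>. Trinomial revision splits off
  the factor free of \<open>j\<close>, and the Vandermonde convolution sums the rest.\<close>

lemma jc_conv_sum:
  assumes "m \<le> n"
  shows "jc a b n m = (\<Sum>j\<le>m. ((real n + a) gchoose j) * ((real n + b) gchoose (n - j)) *
     real ((n - j) choose (m - j)) * (-2) ^ (n - m)) / 2 ^ n"
proof -
  have e: "((real n + b) gchoose (n - j)) * real ((n - j) choose (m - j))
       = ((real n + b) gchoose (n - m)) * ((b + real m) gchoose (m - j))" if "j \<le> m" for j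
  proof -
    have "(n - j) choose (m - j) = (n - j) choose (n - m)"
      using that assms binomial_symmetric[of "m - j" "n - j"] by simp
    then have "((real n + b) gchoose (n - j)) * real ((n - j) choose (m - j))
       = ((real n + b) gchoose (n - j)) * (real (n - j) gchoose (n - m))"
      by (simp add: binomial_gbinomial)
    also have "\<dots> = ((real n + b) gchoose (n - m)) *
        ((real n + b - real (n - m)) gchoose (n - j - (n - m)))"
      by (rule gbinomial_trinomial_revision) (use that assms in simp)
    also have "real n + b - real (n - m) = b + real m" using assms by simp
    also have "n - j - (n - m) = m - j" using assms that by simp
    finally show ?thesis .
  qed
  have "(\<Sum>j\<le>m. ((real n + a) gchoose j) * ((real n + b) gchoose (n - j)) *
       real ((n - j) choose (m - j)) * (-2) ^ (n - m))
     = (\<Sum>j\<le>m. (((real n + a) gchoose j) * ((b + real m) gchoose (m - j))) *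
        (((real n + b) gchoose (n - m)) * (-2) ^ (n - m)))"
    by (rule sum.cong) (use e in \<open>auto simp: mult.assoc mult.left_commute\<close>)
  also have "\<dots> = ((real n + a + (b + real m)) gchoose m) *
      (((real n + b) gchoose (n - m)) * (-2) ^ (n - m))"
    using gbinomial_Vandermonde[of "real n + a" "b + real m" m]
    unfolding sum_distrib_right[symmetric] atMost_atLeast0 by (rule arg_cong2[where f = "(*)"]) simp
  finally have s: "(\<Sum>j\<le>m. ((real n + a) gchoose j) * ((real n + b) gchoose (n - j)) *
       real ((n - j) choose (m - j)) * (-2) ^ (n - m)) = \<dots>" .
  have "(-2::real) ^ (n - m) / 2 ^ n = (-1) ^ (n - m) / 2 ^ m"
  proof -
    have "(2::real) ^ n = 2 ^ (n - m) * 2 ^ m" using assms by (simp flip: power_add)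
    moreover have "(-2::real) ^ (n - m) = (-1) ^ (n - m) * 2 ^ (n - m)"
      by (simp flip: power_mult_distrib)
    ultimately show ?thesis by simp
  qed
  then have "((real n + a + (b + real m)) gchoose m) * (((real n + b) gchoose (n - m)) * (-2) ^ (n - m)) / 2 ^ n
      = ((real n + a + b + real m) gchoose m) * ((real n + b) gchoose (n - m)) * ((-1) ^ (n - m) / 2 ^ m)"
    by (simp only: add.assoc mult.assoc times_divide_eq_right[symmetric])
  then show ?thesis unfolding s using assms by (simp add: jc_def mult_ac)
qed

lemma jacobi_poly_conv: "jacobi_poly a b n = (\<Sum>m\<le>n. smult (jc a b n m) ([:1, 1:] ^ m))"
proof -
  define q where "q j = ((real n + a) gchoose j) * ((real n + b) gchoose (n - j))" for j
  have z: "([:-1, 1:] :: real poly) ^ (n - j) * [:1, 1:] ^ j =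
      (\<Sum>m\<in>{j..n}. smult (real ((n - j) choose (m - j)) * (-2) ^ (n - m)) ([:1, 1:] ^ m))"
    if "j \<le> n" for j
  proof -
    have "([:-1, 1:] :: real poly) = [:1, 1:] + [:-2:]" by simp
    then have "([:-1, 1:] :: real poly) ^ (n - j) = (\<Sum>i\<le>n - j. of_nat ((n - j) choose i) *
        [:1, 1:] ^ i * [:-2:] ^ (n - j - i))"
      by (simp only: binomial_ring)
    also have "\<dots> = (\<Sum>i\<le>n - j. smult (real ((n - j) choose i) * (-2) ^ (n - j - i)) ([:1, 1:] ^ i))"
      by (rule sum.cong) (auto simp: of_nat_poly poly_const_pow mult.commute)
    finally have "([:-1, 1:] :: real poly) ^ (n - j) * [:1, 1:] ^ j =
        (\<Sum>i\<le>n - j. smult (real ((n - j) choose i) * (-2) ^ (n - (i + j))) ([:1, 1:] ^ (i + j)))"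
      by (simp add: sum_distrib_right power_add add.commute[of j])
    also have "\<dots> = (\<Sum>m\<in>{j..n}. smult (real ((n - j) choose (m - j)) * (-2) ^ (n - m)) ([:1, 1:] ^ m))"
      by (rule sum.reindex_bij_witness[of _ "\<lambda>m. m - j" "\<lambda>i. i + j"]) (use that in auto)
    finally show ?thesis .
  qed
  have "(\<Sum>j\<le>n. smult (q j) ([:-1, 1:] ^ (n - j) * [:1, 1:] ^ j))
     = (\<Sum>j\<le>n. \<Sum>m\<in>{j..n}. smult (q j * (real ((n - j) choose (m - j)) * (-2) ^ (n - m))) ([:1, 1:] ^ m))"
    by (rule sum.cong) (auto simp: z smult_sum_right)
  also have "\<dots> = (\<Sum>m\<le>n. \<Sum>j\<le>m. smult (q j * (real ((n - j) choose (m - j)) * (-2) ^ (n - m))) ([:1, 1:] ^ m))"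
    by (subst sum.Sigma; (simp; fail)?; subst sum.Sigma; (simp; fail)?)
       (rule sum.reindex_bij_witness[of _ "\<lambda>(m, j). (j, m)" "\<lambda>(j, m). (m, j)"], auto)
  also have "\<dots> = (\<Sum>m\<le>n. smult (2 ^ n * jc a b n m) ([:1, 1:] ^ m))"
    by (rule sum.cong) (auto simp: jc_conv_sum q_def smult_sum mult.assoc)
  finally show ?thesis
    by (simp add: jacobi_poly_def q_def smult_sum_right)
qed

text \<open>Coefficient form of a derivative rule: \<open>(1 + x)^b\<close> times the Jacobi
  polynomial for \<open>a, b\<close> has derivative \<open>(n + b) (1 + x)^(b - 1)\<close> times the
  one for \<open>a + 1, b - 1\<close>.\<close>

lemma jc_theta: "jc a b n m * (real m + b) = (real n + b) * jc (a + 1) (b - 1) n m"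
proof (cases "m \<le> n")
  case True
  have "real n + b - real (n - m) = real m + b" using True by simp
  then have e: "((real n + b) gchoose (n - m)) * (real m + b)
      = (real n + b) * ((real n + (b - 1)) gchoose (n - m))"
    using gbinomial_absorb_comp[of "real n + b" "n - m"] by (metis mult.commute add_diff_eq)
  moreover have "real n + (a + 1) + (b - 1) + real m = real n + a + b + real m" by simp
  ultimately have "jc (a + 1) (b - 1) n m = (-1) ^ (n - m) / 2 ^ m
      * ((real n + (b - 1)) gchoose (n - m)) * ((real n + a + b + real m) gchoose m)"
    using True by (simp only: jc_def if_True)
  then have "(real n + b) * jc (a + 1) (b - 1) n m = (-1) ^ (n - m) / 2 ^ m
      * ((real n + b) * ((real n + (b - 1)) gchoose (n - m))) * ((real n + a + b + real m) gchoose m)"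
    by simp
  also have "\<dots> = jc a b n m * (real m + b)"
    unfolding e[symmetric] using True by (simp add: jc_def)
  finally show ?thesis ..
qed (simp add: jc_def)

text \<open>The Jacobi differential equation, read off in powers of \<open>1 + x\<close>.\<close>

lemma jc_rec:
  "2 * (real m + 1) * (real m + 1 + b) * jc a b n (Suc m)
     = - (real n - real m) * (real n + real m + a + b + 1) * jc a b n m"
proof (cases "Suc m \<le> n")
  case True
  define k where "k = n - Suc m"
  have nm: "n - m = Suc k" "n - Suc m = k" and n: "real n = real m + 1 + real k"
    using True by (auto simp: k_def)
  have 1: "(real m + 1 + b) * ((real n + b) gchoose k) = (real k + 1) * ((real n + b) gchoose Suc k)"
    using gbinomial_absorption[of k "real n + b"] gbinomial_absorb_comp[of "real n + b" k] n
    by (simp add: algebra_simps)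
  have 2: "(real m + 1) * ((real n + a + b + real (Suc m)) gchoose Suc m)
     = (real n + real m + a + b + 1) * ((real n + a + b + real m) gchoose m)"
    using gbinomial_absorption[of m "real n + a + b + real (Suc m)"]
    by (simp add: algebra_simps)
  have "2 * (real m + 1) * (real m + 1 + b) * jc a b n (Suc m)
      = 2 * ((-1) ^ k / 2 ^ Suc m) * ((real m + 1 + b) * ((real n + b) gchoose k))
        * ((real m + 1) * ((real n + a + b + real (Suc m)) gchoose Suc m))"
    using True unfolding jc_def nm by (simp only: if_True mult_ac times_divide_eq_left times_divide_eq_right)
  also have "\<dots> = 2 * ((-1) ^ k / 2 ^ Suc m) * ((real k + 1) * ((real n + b) gchoose Suc k))
        * ((real n + real m + a + b + 1) * ((real n + a + b + real m) gchoose m))"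
    unfolding 1 2 ..
  also have "real k + 1 = real n - real m" using n by simp
  also have "2 * ((-1) ^ k / 2 ^ Suc m) = - ((-1::real) ^ Suc k / 2 ^ m)" by simp
  also have "- ((-1) ^ Suc k / 2 ^ m) * ((real n - real m) * ((real n + b) gchoose Suc k))
        * ((real n + real m + a + b + 1) * ((real n + a + b + real m) gchoose m))
      = - (real n - real m) * (real n + real m + a + b + 1) * jc a b n m"
  proof -
    define s A B where "s = (-1::real) ^ Suc k" and "A = (real n + b) gchoose Suc k"
      and "B = (real n + a + b + real m) gchoose m"
    have "jc a b n m = s / 2 ^ m * A * B"
      using True by (simp add: jc_def nm s_def A_def B_def)
    then show ?thesis by (simp add: s_def [symmetric] A_def [symmetric] B_def [symmetric] del: power_Suc)
        (simp add: divide_simps, simp add: algebra_simps)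
  qed
  finally show ?thesis .
next
  case False
  then show ?thesis by (cases "m = n") (auto simp: jc_def)
qed

text \<open>Iteration of \<open>jc_theta\<close>. For \<open>b = - \<beta>\<close> the Pochhammer
  symbol is the one in the \<open>F2\<close> rows of \<open>W_mat\<close>.\<close>

lemma jc_theta_pochhammer:
  "jc a b n m * (\<Prod>i<j. real m + b - real i)
     = (-1) ^ j * pochhammer (- b - real n) j * jc (a + real j) (b - real j) n m"
proof (induction j)
  case (Suc j)
  have "jc (a + real j) (b - real j) n m * (real m + b - real j)
      = (real n + b - real j) * jc (a + real (Suc j)) (b - real (Suc j)) n m"
    using jc_theta[of "a + real j" "b - real j" n m] by (simp add: algebra_simps)
  then have e: "(real m + b - real j) * jc (a + real j) (b - real j) n m
      = - ((- b - real n + real j) * jc (a + real (Suc j)) (b - real (Suc j)) n m)"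
    by (simp add: algebra_simps)
  have "jc a b n m * (\<Prod>i<Suc j. real m + b - real i)
      = (-1) ^ j * pochhammer (- b - real n) j * ((real m + b - real j) * jc (a + real j) (b - real j) n m)"
    using Suc by (simp add: mult_ac)
  then show ?case unfolding e by (simp add: pochhammer_Suc mult_ac)
qed simp

lemma jc_top: "jc a b n n = ((2 * real n + a + b) gchoose n) / 2 ^ n"
  by (simp add: jc_def algebra_simps)

section \<open>Twisted series in powers of \<open>1 + x\<close>\<close>

definition ffact :: "real \<Rightarrow> nat \<Rightarrow> real" where
  "ffact x j = (\<Prod>i<j. x - real i)"

text \<open>\<open>(1 + x)\<^sup>j\<close> times the \<open>j\<close>-th derivative of \<open>\<Sum>\<^sub>m c\<^sub>m (1 + x)\<^bsup>m + b\<^esup>\<close>, up to the factor \<open>(1 + x)\<^sup>b\<close>.\<close>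

definition trow :: "real \<Rightarrow> (nat \<Rightarrow> real) \<Rightarrow> nat \<Rightarrow> nat \<Rightarrow> real poly" where
  "trow b c N j = (\<Sum>m\<le>N. smult (c m * ffact (real m + b) j) (Y ^ m))"

lemma pderiv_sum: "pderiv (sum f A) = (\<Sum>i\<in>A. pderiv (f i))"
  by (induction A rule: infinite_finite_induct) (auto simp: pderiv_add)

lemma Y_pderiv_power: "Y * pderiv (Y ^ m) = smult (real m) (Y ^ m)"
proof (cases m)
  case (Suc k)
  have "pderiv (Y ^ m) = smult (real m) (Y ^ k)"
    unfolding Suc pderiv_power_Suc pderiv_Y by simp
  then show ?thesis unfolding Suc by (simp add: mult_smult_right)
qed (simp add: pderiv_1)

lemma trow_Suc: "trow b c N (Suc j) = Y * pderiv (trow b c N j) + smult (b - real j) (trow b c N j)"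
proof -
  have "Y * pderiv (trow b c N j) = (\<Sum>m\<le>N. smult (c m * ffact (real m + b) j) (Y * pderiv (Y ^ m)))"
    by (simp only: trow_def pderiv_sum pderiv_smult sum_distrib_left mult_smult_right)
  then show ?thesis
    unfolding Y_pderiv_power
    by (simp add: trow_def smult_sum_right ffact_def flip: sum.distrib smult_add_left)
       (simp add: algebra_simps)
qed

text \<open>Multiplication by \<open>(1 + x)^j\<close> clears the poles that the twist
  \<open>b / (1 + x)\<close> produces; the induction step is \<open>trow_Suc\<close>.\<close>

lemma tw_trow:
  "(fd.tw (cst b / to_fract Y) ^^ j) (to_fract (trow b c N 0)) * to_fract Y ^ j
     = to_fract (trow b c N j)"
proof (induction j)
  case (Suc j)
  define y where "y = to_fract Y"
  define h where "h = (fd.tw (cst b / y) ^^ j) (to_fract (trow b c N 0))"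
  define g where "g = to_fract (trow b c N j)"
  have hg: "h * y ^ j = g" using Suc by (simp add: h_def y_def g_def)
  have y: "y \<noteq> 0" "fract_deriv y = 1" by (simp_all add: y_def pderiv_Y del: pderiv.simps)
  have p: "of_nat j * y ^ (j - 1) * y = of_nat j * y ^ j" by (cases j) simp_all
  have "fract_deriv g = fract_deriv h * y ^ j + h * (of_nat j * y ^ (j - 1))"
    unfolding hg[symmetric] fd.d_mult fd.d_power y(2) by simp
  then have "fract_deriv g * y = fract_deriv h * y ^ Suc j + h * (of_nat j * y ^ (j - 1) * y)"
    by (simp add: algebra_simps)
  also have "\<dots> = fract_deriv h * y ^ Suc j + of_nat j * g"
    unfolding p hg[symmetric] by simp
  finally have 1: "fract_deriv h * y ^ Suc j = fract_deriv g * y - of_nat j * g" by simp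
  have "fd.tw (cst b / y) h * y ^ Suc j = fract_deriv h * y ^ Suc j + cst b * (h * y ^ j)"
    using y(1) by (simp add: fd.tw_def field_simps)
  also have "\<dots> = y * fract_deriv g + (cst b - of_nat j) * g"
    unfolding 1 hg by (simp add: algebra_simps)
  also have "\<dots> = to_fract (trow b c N (Suc j))"
    unfolding trow_Suc
    by (simp only: to_fract_add to_fract_mult to_fract_smult y_def g_def fract_deriv_to_fract
        cst_diff cst_of_nat)
  finally show ?case by (simp add: h_def y_def)
qed simp

text \<open>Frobenius method at -1: the indicial equation \<open>b * (b + \<beta>) = 0\<close>
  removes the lowest term, and \<open>c (Suc N) = 0\<close> terminates the series. The exponents 0
  and \<open>- \<beta>\<close> yield the two kinds of seeds.\<close>

lemma trow_eigenfun:
  assumes rec: "\<And>m. 2 * (real m + 1 + b) * (real m + 1 + b + \<beta>) * c (Suc m)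
      = - (\<theta> - (real m + b) * (real m + b + \<alpha> + \<beta> + 1)) * c m"
    and b: "b * (b + \<beta>) = 0" and N: "c (Suc N) = 0"
  shows "fd.eigenfun (to_fract (Y * Z)) (cst (2 * \<beta> + 2) - cst (\<alpha> + \<beta> + 2) * to_fract Y) 0
     (cst b / to_fract Y) (to_fract (trow b c N 0)) (cst \<theta>)"
proof -
  define y where "y = to_fract Y"
  define v where "v = to_fract (trow b c N 0)"
  define T where "T j = trow b c N j" for j
  have y: "y \<noteq> 0" by (simp add: y_def)
  have t1: "fd.tw (cst b / y) v * y = to_fract (T 1)"
    using tw_trow[where b = b and j = 1 and c = c and N = N] by (simp add: y_def v_def T_def)
  have t2: "fd.tw (cst b / y) (fd.tw (cst b / y) v) * y\<^sup>2 = to_fract (T 2)"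
    using tw_trow[where b = b and j = 2 and c = c and N = N] by (simp add: y_def v_def T_def numeral_2_eq_2)
  \<comment> \<open>After multiplication by \<open>y\<close> and with \<open>Z = 2 - Y\<close>,
    \<open>A m\<close> collects the terms that keep the degree and \<open>B m\<close> those that
    raise it by one; the recurrence makes them cancel.\<close>
  define A where "A m = 2 * c m * (real m + b) * (real m + b + \<beta>)" for m
  define B where "B m = c m * (\<theta> - (real m + b) * (real m + b + \<alpha> + \<beta> + 1))" for m
  have A0: "A 0 = 0" using b by (simp add: A_def)
  have AB: "A (Suc m) = - B m" for m
    using rec[of m] unfolding A_def B_def by (simp add: algebra_simps)
  have BN: "B N = 0" using AB[of N] N by (simp add: A_def)
  have Z: "Z = [:2:] - Y" by simp
  have "Z * T 2 + smult (2 * \<beta> + 2) (T 1) - smult (\<alpha> + \<beta> + 2) (Y * T 1) + smult \<theta> (Y * T 0)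
     = (smult 2 (T 2) + smult (2 * \<beta> + 2) (T 1)) +
       Y * (smult \<theta> (T 0) - T 2 - smult (\<alpha> + \<beta> + 2) (T 1))"
  proof -
    have "([:2:] - P) * R + S - smult k (P * S') + smult l (P * U)
        = (smult 2 R + S) + P * (smult l U - R - smult k S')" for P R S S' U :: "real poly" and k l
      by (simp add: algebra_simps mult_smult_right)
    then show ?thesis unfolding Z by blast
  qed
  also have "smult 2 (T 2) + smult (2 * \<beta> + 2) (T 1) = (\<Sum>m\<le>N. smult (A m) (Y ^ m))"
    unfolding T_def trow_def smult_sum_right
    by (simp add: A_def ffact_def numeral_2_eq_2 flip: sum.distrib smult_add_left)
       (simp add: algebra_simps)
  also have "smult \<theta> (T 0) - T 2 - smult (\<alpha> + \<beta> + 2) (T 1) = (\<Sum>m\<le>N. smult (B m) (Y ^ m))"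
    unfolding T_def trow_def smult_sum_right
    by (simp add: B_def ffact_def numeral_2_eq_2 flip: sum_subtractf smult_diff_left)
       (simp add: algebra_simps)
  also have "(\<Sum>m\<le>N. smult (A m) (Y ^ m)) = (\<Sum>m<N. smult (A (Suc m)) (Y ^ Suc m))"
    by (simp add: sum.atMost_shift A0 del: power_Suc)
  also have "Y * (\<Sum>m\<le>N. smult (B m) (Y ^ m)) = (\<Sum>m<N. smult (B m) (Y ^ Suc m))"
    by (simp add: sum_distrib_left lessThan_Suc_atMost[symmetric] BN mult_smult_right
        del: mult_pCons_left)
  also have "(\<Sum>m<N. smult (A (Suc m)) (Y ^ Suc m)) + (\<Sum>m<N. smult (B m) (Y ^ Suc m)) = 0"
    by (simp add: AB del: power_Suc flip: sum.distrib)
  finally have "to_fract (Z * T 2 + smult (2 * \<beta> + 2) (T 1) - smult (\<alpha> + \<beta> + 2) (Y * T 1)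
      + smult \<theta> (Y * T 0)) = 0"
    by (simp only: to_fract_0)
  then have 0: "to_fract Z * to_fract (T 2) + cst (2 * \<beta> + 2) * to_fract (T 1)
      - cst (\<alpha> + \<beta> + 2) * (y * to_fract (T 1)) + cst \<theta> * (y * v) = 0"
    by (simp only: to_fract_add to_fract_diff to_fract_mult to_fract_smult y_def v_def T_def)
  have "(y * to_fract Z * fd.tw (cst b / y) (fd.tw (cst b / y) v)
      + (cst (2 * \<beta> + 2) - cst (\<alpha> + \<beta> + 2) * y) * fd.tw (cst b / y) v + cst \<theta> * v) * y = 0"
    using 0 unfolding t1[symmetric] t2[symmetric] by (simp add: algebra_simps power2_eq_square)
  then show ?thesis
    using y unfolding fd.eigenfun_def y_def v_def to_fract_mult by simp
qed

text \<open>Pearson's equation for the weight \<open>(1 - x)^\<alpha> (1 + x)^\<beta>\<close>, whose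
  logarithmic derivative is the last factor. It supplies the hypothesis on \<open>r\<close> in
  \<open>crum_norm\<close>.\<close>

lemma omega_relation:
  "cst (2 * \<beta> + 2) - cst (\<alpha> + \<beta> + 2) * to_fract Y = fract_deriv (to_fract (Y * Z))
     + to_fract (Y * Z) * (cst \<beta> / to_fract Y - cst \<alpha> / to_fract Z)"
proof -
  have "fract_deriv (to_fract (Y * Z)) = to_fract (Z - Y)"
    unfolding fract_deriv_to_fract pderiv_mult pderiv_Y pderiv_Z by simp
  moreover have "to_fract (Y * Z) * (cst \<beta> / to_fract Y - cst \<alpha> / to_fract Z)
      = to_fract (smult \<beta> Z - smult \<alpha> Y)"
    by (simp add: field_simps to_fract_smult del: mult_pCons_left mult_pCons_right smult_pCons)
  moreover have "cst (2 * \<beta> + 2) - cst (\<alpha> + \<beta> + 2) * to_fract Y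
      = to_fract ([:2 * \<beta> + 2:] - smult (\<alpha> + \<beta> + 2) Y)"
    by (simp only: cst_def[of "2 * \<beta> + 2"] to_fract_diff to_fract_smult)
  moreover have "[:2 * \<beta> + 2:] - smult (\<alpha> + \<beta> + 2) Y = Z - Y + (smult \<beta> Z - smult \<alpha> Y)"
    by (simp add: algebra_simps)
  ultimately show ?thesis by (simp only: to_fract_add)
qed

subsection \<open>Wronskian determinants and their order at -1\<close>

lemma det_scale:
  fixes f :: "nat \<Rightarrow> nat \<Rightarrow> 'a::comm_ring_1"
  shows "Determinant.det (Matrix.mat K K (\<lambda>(i, j). h i * f i j * g j)) =
    (\<Prod>i<K. h i) * (\<Prod>j<K. g j) * Determinant.det (Matrix.mat K K (\<lambda>(i, j). f i j))"
proof -
  have "(\<Prod>i = 0..<K. h i * f i (\<pi> i) * g (\<pi> i)) =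
      (\<Prod>i<K. h i) * (\<Prod>j<K. g j) * (\<Prod>i = 0..<K. f i (\<pi> i))"
    if "\<pi> permutes {0..<K}" for \<pi>
  proof -
    have "(\<Prod>i = 0..<K. g (\<pi> i)) = (\<Prod>i = 0..<K. g i)"
      using prod.permute[OF that, of g] by (simp add: o_def)
    then show ?thesis by (simp add: prod.distrib lessThan_atLeast0 mult_ac)
  qed
  moreover have "\<pi> i < K" if "\<pi> permutes {0..<K}" "i < K" for \<pi> i
    using that permutes_in_image[of \<pi> "{0..<K}" i] by simp
  ultimately show ?thesis
    by (subst (1 2) det_def'[of _ K]) (auto simp: sum_distrib_left mult_ac intro!: sum.cong)
qed

lemma det_expand_rows:
  fixes M :: "nat \<Rightarrow> 'b \<Rightarrow> nat \<Rightarrow> 'a::comm_ring_1"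
  assumes "finite S"
  shows "Determinant.det (Matrix.mat K K (\<lambda>(i, j). \<Sum>m\<in>S. M i m j)) =
    (\<Sum>g\<in>PiE {..<K} (\<lambda>_. S). Determinant.det (Matrix.mat K K (\<lambda>(i, j). M i (g i) j)))"
proof -
  have p: "\<pi> i < K" if "\<pi> permutes {0..<K}" "i < K" for \<pi> i
    using that permutes_in_image[of \<pi> "{0..<K}" i] by simp
  have "Determinant.det (Matrix.mat K K (\<lambda>(i, j). \<Sum>m\<in>S. M i m j))
     = (\<Sum>\<pi> | \<pi> permutes {0..<K}. signof \<pi> * (\<Prod>i<K. \<Sum>m\<in>S. M i m (\<pi> i)))"
    using p by (subst det_def'[of _ K]) (auto simp: lessThan_atLeast0 intro!: sum.cong)
  also have "\<dots> = (\<Sum>\<pi> | \<pi> permutes {0..<K}. \<Sum>g\<in>PiE {..<K} (\<lambda>_. S).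
      signof \<pi> * (\<Prod>i<K. M i (g i) (\<pi> i)))"
    using assms by (subst prod_sum_PiE) (auto simp: sum_distrib_left)
  also have "\<dots> = (\<Sum>g\<in>PiE {..<K} (\<lambda>_. S). \<Sum>\<pi> | \<pi> permutes {0..<K}.
      signof \<pi> * (\<Prod>i<K. M i (g i) (\<pi> i)))"
    by (rule sum.swap)
  also have "\<dots> = (\<Sum>g\<in>PiE {..<K} (\<lambda>_. S). Determinant.det (Matrix.mat K K (\<lambda>(i, j). M i (g i) j)))"
    using p by (subst det_def'[of _ K]) (auto simp: lessThan_atLeast0 intro!: sum.cong)
  finally show ?thesis .
qed

lemma det_const_poly:
  fixes f :: "nat \<Rightarrow> nat \<Rightarrow> real"
  shows "Determinant.det (Matrix.mat K K (\<lambda>(i, j). [:f i j:])) =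
    [:Determinant.det (Matrix.mat K K (\<lambda>(i, j). f i j)):]"
proof -
  interpret h: comm_ring_hom "\<lambda>r::real. [:r:]"
    by unfold_locales (auto simp: one_pCons)
  have "Matrix.mat K K (\<lambda>(i, j). [:f i j:]) = map_mat (\<lambda>r. [:r:]) (Matrix.mat K K (\<lambda>(i, j). f i j))"
    by (rule eq_matI) auto
  then show ?thesis by simp
qed

text \<open>The generalised Vandermonde determinant that remains when row \<open>i\<close> is a single power
  \<open>(1 + x)\<close> to the exponent \<open>g i + b i\<close>.\<close>

definition gvd :: "nat \<Rightarrow> (nat \<Rightarrow> real) \<Rightarrow> (nat \<Rightarrow> nat) \<Rightarrow> real" where
  "gvd K b g = Determinant.det (Matrix.mat K K (\<lambda>(i, j). ffact (real (g i) + b i) j))"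

definition trow_det :: "nat \<Rightarrow> (nat \<Rightarrow> real) \<Rightarrow> (nat \<Rightarrow> nat \<Rightarrow> real) \<Rightarrow> nat \<Rightarrow> real poly" where
  "trow_det K b c N = Determinant.det (Matrix.mat K K (\<lambda>(i, j). trow (b i) (c i) N j))"

text \<open>Multilinearity selects one monomial per row. Its power of \<open>Y\<close> is the same
  in all columns and leaves the determinant, so that only constants remain inside.\<close>

lemma trow_det_expand:
  "trow_det K b c N = (\<Sum>g\<in>PiE {..<K} (\<lambda>_. {..N}).
     smult ((\<Prod>i<K. c i (g i)) * gvd K b g) (Y ^ (\<Sum>i<K. g i)))"
proof -
  have "trow_det K b c N = (\<Sum>g\<in>PiE {..<K} (\<lambda>_. {..N}).
     Determinant.det (Matrix.mat K K (\<lambda>(i, j). smult (c i (g i) * ffact (real (g i) + b i) j) (Y ^ g i))))"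
    unfolding trow_det_def trow_def by (rule det_expand_rows) simp
  also have "\<dots> = (\<Sum>g\<in>PiE {..<K} (\<lambda>_. {..N}).
     smult ((\<Prod>i<K. c i (g i)) * gvd K b g) (Y ^ (\<Sum>i<K. g i)))"
  proof (rule sum.cong[OF refl])
    fix g
    have "Determinant.det (Matrix.mat K K (\<lambda>(i, j). smult (c i (g i) * ffact (real (g i) + b i) j) (Y ^ g i)))
       = Determinant.det (Matrix.mat K K (\<lambda>(i, j). ([:c i (g i):] * Y ^ g i)
           * [:ffact (real (g i) + b i) j:] * 1))"
      by (rule arg_cong[of _ _ Determinant.det], rule eq_matI) (auto simp: mult_smult_right mult_ac)
    also have "\<dots> = (\<Prod>i<K. [:c i (g i):] * Y ^ g i) * [:gvd K b g:]"
      unfolding det_scale[where h = "\<lambda>i. [:c i (g i):] * Y ^ g i" and g = "\<lambda>_. 1"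
          and f = "\<lambda>i j. [:ffact (real (g i) + b i) j:]"] det_const_poly gvd_def by simp
    also have "(\<Prod>i<K. [:c i (g i):] * y ^ g i) = smult (\<Prod>i<K. c i (g i)) (y ^ (\<Sum>i<K. g i))" for y
      by (induction K) (simp_all add: power_add mult_ac)
    finally show "Determinant.det (Matrix.mat K K (\<lambda>(i, j). smult (c i (g i) * ffact (real (g i) + b i) j) (Y ^ g i)))
       = smult ((\<Prod>i<K. c i (g i)) * gvd K b g) (Y ^ (\<Sum>i<K. g i))"
      by (simp add: mult.commute)
  qed
  finally show ?thesis .
qed

text \<open>The number \<open>n (n - 1) / 2\<close>: the least sum of \<open>n\<close> distinct
  naturals, and the total exponent when each column \<open>j < n\<close> is scaled by
  \<open>Y ^ j\<close>.\<close>

definition tri :: "nat \<Rightarrow> nat" where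
  "tri n = (\<Sum>i<n. i)"

lemma tri_real: "2 * real (tri n) = real n * (real n - 1)"
proof (induction n)
  case (Suc n)
  have "real (tri (Suc n)) = real (tri n) + real n" by (simp add: tri_def)
  then show ?case using Suc by (simp add: algebra_simps)
qed (simp add: tri_def)

lemma tri_le_sum:
  assumes "finite A" "card A = n"
  shows "tri n \<le> \<Sum>A"
  using assms
proof (induction n arbitrary: A)
  case (Suc n)
  have fin: "finite A" and card: "card A = Suc n" using Suc.prems by auto
  have "A \<noteq> {}" using card by auto
  then have M: "Max A \<in> A" using fin by simp
  have "tri n \<le> \<Sum>(A - {Max A})"
    by (rule Suc.IH) (use fin card M in auto)
  moreover have "n \<le> Max A"
  proof -
    have "A \<subseteq> {..Max A}" using fin by auto
    then have "card A \<le> card {..Max A}" by (intro card_mono) auto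
    then show ?thesis using card by simp
  qed
  moreover have "\<Sum>A = Max A + \<Sum>(A - {Max A})"
    by (rule sum.remove[OF fin M])
  moreover have "tri (Suc n) = tri n + n" by (simp add: tri_def)
  ultimately show ?case by linarith
qed (simp add: tri_def)

lemma gvd_eq_0:
  assumes "i < K" "i' < K" "i \<noteq> i'" "b i = b i'" "g i = g i'"
  shows "gvd K b g = 0"
  unfolding gvd_def
  by (rule det_identical_rows[OF _ assms(3,1,2)]) (use assms in \<open>auto intro!: eq_vecI\<close>)

text \<open>Only row selections that are injective on each of the two exponent classes contribute.\<close>

lemma tri_le_sum_gvd:
  assumes "gvd K b g \<noteq> 0" "S \<union> S' = {..<K}" "S \<inter> S' = {}"
    and "\<And>i. i \<in> S \<Longrightarrow> b i = \<beta>" "\<And>i. i \<in> S' \<Longrightarrow> b i = \<beta>'"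
  shows "tri (card S) + tri (card S') \<le> (\<Sum>i<K. g i)"
proof -
  have fin: "finite S" "finite S'"
    using assms(2) by (metis finite_Un finite_lessThan)+
  have *: "tri (card T) \<le> sum g T" if "T \<subseteq> {..<K}" "finite T" "\<And>i. i \<in> T \<Longrightarrow> b i = x" for T x
  proof -
    have "inj_on g T"
      using that gvd_eq_0[of _ K _ b g] assms(1) by (intro inj_onI) (metis lessThan_iff subsetD)
    then have "sum g T = \<Sum>(g ` T)" "card (g ` T) = card T"
      by (simp_all add: sum.reindex card_image)
    then show ?thesis using tri_le_sum[of "g ` T" "card T"] that by simp
  qed
  have "(\<Sum>i<K. g i) = sum g S + sum g S'"
    using sum.union_disjoint[of S S' g] fin assms by simp
  moreover have "tri (card S) \<le> sum g S" using assms fin by (intro *[of S \<beta>]) auto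
  moreover have "tri (card S') \<le> sum g S'" using assms fin by (intro *[of S' \<beta>']) auto
  ultimately show ?thesis by simp
qed

text \<open>Where the truncated difference in the exponent is not the true one, the coefficient vanishes.\<close>

definition trow_red :: "nat \<Rightarrow> (nat \<Rightarrow> real) \<Rightarrow> (nat \<Rightarrow> nat \<Rightarrow> real) \<Rightarrow> nat \<Rightarrow> nat \<Rightarrow> real poly" where
  "trow_red K b c N T = (\<Sum>g\<in>PiE {..<K} (\<lambda>_. {..N}).
     smult ((\<Prod>i<K. c i (g i)) * gvd K b g) (Y ^ ((\<Sum>i<K. g i) - T)))"

lemma trow_det_conv_red:
  assumes "S \<union> S' = {..<K}" "S \<inter> S' = {}"
    and "\<And>i. i \<in> S \<Longrightarrow> b i = \<beta>" "\<And>i. i \<in> S' \<Longrightarrow> b i = \<beta>'"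
    and T: "T = tri (card S) + tri (card S')"
  shows "trow_det K b c N = Y ^ T * trow_red K b c N T"
  unfolding trow_det_expand trow_red_def sum_distrib_left
proof (rule sum.cong[OF refl])
  fix g
  show "smult ((\<Prod>i<K. c i (g i)) * gvd K b g) (Y ^ (\<Sum>i<K. g i)) =
      Y ^ T * smult ((\<Prod>i<K. c i (g i)) * gvd K b g) (Y ^ ((\<Sum>i<K. g i) - T))"
  proof (cases "gvd K b g = 0")
    case False
    then have "T \<le> (\<Sum>i<K. g i)" unfolding T by (rule tri_le_sum_gvd[OF _ assms(1-4)])
    then have "Y ^ (\<Sum>i<K. g i) = Y ^ T * Y ^ ((\<Sum>i<K. g i) - T)"
      by (simp flip: power_add)
    then show ?thesis by (simp add: mult_smult_right)
  qed simp
qed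

text \<open>Scaling column \<open>j\<close> by \<open>Y ^ j\<close> makes all entries of the
  Wronskian matrix polynomial.\<close>

lemma det_wr_trow:
  "Determinant.det (fd.wr_mat (\<lambda>i. cst (b i) / to_fract Y) (\<lambda>i. to_fract (trow (b i) (c i) N 0)) K)
     * to_fract Y ^ tri K = to_fract (trow_det K b c N)"
proof -
  interpret h: comm_ring_hom "to_fract :: real poly \<Rightarrow> real poly fract"
    by unfold_locales auto
  let ?f = "\<lambda>i j. (fd.tw (cst (b i) / to_fract Y) ^^ j) (to_fract (trow (b i) (c i) N 0))"
  have "Determinant.det (Matrix.mat K K (\<lambda>(i, j). 1 * ?f i j * to_fract Y ^ j))
      = (\<Prod>j<K. to_fract Y ^ j) * Determinant.det (Matrix.mat K K (\<lambda>(i, j). ?f i j))"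
    using det_scale[where h = "\<lambda>_. 1" and f = ?f and g = "\<lambda>j. to_fract Y ^ j" and K = K]
    by (simp only: prod.neutral_const mult_1)
  also have "(\<Prod>j<K. to_fract Y ^ j) = to_fract Y ^ tri K"
    by (simp add: tri_def power_sum)
  also have "Matrix.mat K K (\<lambda>(i, j). 1 * ?f i j * to_fract Y ^ j)
      = map_mat to_fract (Matrix.mat K K (\<lambda>(i, j). trow (b i) (c i) N j))"
    by (rule eq_matI) (auto simp: tw_trow)
  finally show ?thesis
    by (simp add: trow_det_def fd.wr_mat_def mult.commute)
qed

section \<open>The rows of \<open>W_mat\<close> as twisted series, and \<open>Omega_poly\<close> as
  a reduced determinant\<close>

lemma jacobi_poly_trow:
  assumes "n \<le> N"
  shows "trow b (jc a b' n) N 0 = jacobi_poly a b' n"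
proof -
  have "(\<Sum>m\<le>N. smult (jc a b' n m) (Y ^ m)) = (\<Sum>m\<le>n. smult (jc a b' n m) (Y ^ m))"
    using assms by (intro sum.mono_neutral_right) (auto simp: jc_def)
  then show ?thesis by (simp add: trow_def ffact_def jacobi_poly_conv)
qed

lemma trow_jacobi:
  assumes "n \<le> N"
  shows "trow b (jc a b n) N j =
    smult ((-1) ^ j * pochhammer (- b - real n) j) (jacobi_poly (a + real j) (b - real j) n)"
proof -
  have "trow b (jc a b n) N j = smult ((-1) ^ j * pochhammer (- b - real n) j)
      (trow b (jc (a + real j) (b - real j) n) N 0)"
    unfolding trow_def ffact_def jc_theta_pochhammer by (simp add: smult_sum_right)
  then show ?thesis using jacobi_poly_trow[OF assms] by simp
qed

lemma trow_pderiv: "trow 0 c N j = Y ^ j * (pderiv ^^ j) (trow 0 c N 0)"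
proof -
  have "(fract_deriv ^^ j) (to_fract p) = to_fract ((pderiv ^^ j) p)" for p
    by (induction j) auto
  then have "to_fract ((pderiv ^^ j) (trow 0 c N 0)) * to_fract Y ^ j = to_fract (trow 0 c N j)"
    using tw_trow[where b = 0 and j = j and c = c and N = N]
    by (simp add: fd.tw_0_left[abs_def])
  then have "to_fract (trow 0 c N j) = to_fract (Y ^ j * (pderiv ^^ j) (trow 0 c N 0))"
    by (simp only: to_fract_mult to_fract_power mult.commute)
  then show ?thesis by (simp only: to_fract_eq_iff)
qed

text \<open>The rows of the extended Wronskian: first \<open>F1\<close>, then \<open>F2\<close>, then one Jacobi
  polynomial of degree \<open>n\<close>.\<close>

definition rdeg :: "nat set \<Rightarrow> nat set \<Rightarrow> nat \<Rightarrow> nat \<Rightarrow> nat" where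
  "rdeg F1 F2 n i = (if i < card F1 then sorted_list_of_set F1 ! i
     else if i < card F1 + card F2 then sorted_list_of_set F2 ! (i - card F1) else n)"

definition rexp :: "nat set \<Rightarrow> nat set \<Rightarrow> real \<Rightarrow> nat \<Rightarrow> real" where
  "rexp F1 F2 \<beta> i = (if i < card F1 then 0 else if i < card F1 + card F2 then - \<beta> else 0)"

definition rpar :: "nat set \<Rightarrow> nat set \<Rightarrow> real \<Rightarrow> nat \<Rightarrow> real" where
  "rpar F1 F2 \<beta> i = (if i < card F1 then \<beta> else if i < card F1 + card F2 then - \<beta> else \<beta>)"

definition rcoeff :: "nat set \<Rightarrow> nat set \<Rightarrow> nat \<Rightarrow> real \<Rightarrow> real \<Rightarrow> nat \<Rightarrow> nat \<Rightarrow> real" where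
  "rcoeff F1 F2 n \<alpha> \<beta> i = jc \<alpha> (rpar F1 F2 \<beta> i) (rdeg F1 F2 n i)"

lemma rdeg_mem:
  assumes "finite F1" "finite F2"
  shows "i < card F1 \<Longrightarrow> rdeg F1 F2 n i \<in> F1"
    and "card F1 \<le> i \<Longrightarrow> i < card F1 + card F2 \<Longrightarrow> rdeg F1 F2 n i \<in> F2"
proof -
  have "sorted_list_of_set F ! i \<in> F" if "finite F" "i < card F" for F :: "nat set" and i
    using nth_mem[of i "sorted_list_of_set F"] that by simp
  then show "i < card F1 \<Longrightarrow> rdeg F1 F2 n i \<in> F1"
    and "card F1 \<le> i \<Longrightarrow> i < card F1 + card F2 \<Longrightarrow> rdeg F1 F2 n i \<in> F2"
    using assms by (simp_all add: rdeg_def)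
qed

definition red_omega :: "nat set \<Rightarrow> nat set \<Rightarrow> nat \<Rightarrow> nat \<Rightarrow> real \<Rightarrow> real \<Rightarrow> real poly" where
  "red_omega F1 F2 n N \<alpha> \<beta> = trow_red (card F1 + card F2) (rexp F1 F2 \<beta>) (rcoeff F1 F2 n \<alpha> \<beta>) N
     (tri (card F1) + tri (card F2))"

text \<open>The appended Jacobi polynomial has exponent 0 like the \<open>F1\<close> rows, so that
  class gains a member and the guaranteed order at -1 grows.\<close>

definition red_ext :: "nat set \<Rightarrow> nat set \<Rightarrow> nat \<Rightarrow> nat \<Rightarrow> real \<Rightarrow> real \<Rightarrow> real poly" where
  "red_ext F1 F2 n N \<alpha> \<beta> = trow_red (Suc (card F1 + card F2)) (rexp F1 F2 \<beta>) (rcoeff F1 F2 n \<alpha> \<beta>) N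
     (tri (Suc (card F1)) + tri (card F2))"

lemma trow_det_omega:
  "trow_det (card F1 + card F2) (rexp F1 F2 \<beta>) (rcoeff F1 F2 n \<alpha> \<beta>) N =
     Y ^ (tri (card F1) + tri (card F2)) * red_omega F1 F2 n N \<alpha> \<beta>"
  unfolding red_omega_def
  by (rule trow_det_conv_red[where S = "{..<card F1}" and S' = "{card F1..<card F1 + card F2}"
        and \<beta> = 0 and \<beta>' = "- \<beta>"]) (auto simp: rexp_def)

lemma trow_det_ext:
  "trow_det (Suc (card F1 + card F2)) (rexp F1 F2 \<beta>) (rcoeff F1 F2 n \<alpha> \<beta>) N =
     Y ^ (tri (Suc (card F1)) + tri (card F2)) * red_ext F1 F2 n N \<alpha> \<beta>"
proof -
  have "card (insert (card F1 + card F2) {..<card F1}) = Suc (card F1)" by simp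
  then show ?thesis
    unfolding red_ext_def
    by (intro trow_det_conv_red[where S = "insert (card F1 + card F2) {..<card F1}"
          and S' = "{card F1..<card F1 + card F2}" and \<beta> = 0 and \<beta>' = "- \<beta>"])
       (auto simp: rexp_def)
qed

text \<open>This is the shape that \<open>det_scale\<close> needs. In an \<open>F2\<close> row,
  \<open>Y ^ (k - Suc j) * Y ^ j\<close> does not depend on \<open>j\<close> and becomes a row
  factor.\<close>

lemma W_mat_entry:
  assumes "i < card F1 + card F2" "j < card F1 + card F2" "rdeg F1 F2 n i \<le> N"
  shows "W_mat \<alpha> \<beta> F1 F2 $$ (i, j) * Y ^ j =
    (if i < card F1 then 1 else Y ^ (card F1 + card F2 - 1)) *
      trow (rexp F1 F2 \<beta> i) (rcoeff F1 F2 n \<alpha> \<beta> i) N j * [:(-1) ^ j:]"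
proof (cases "i < card F1")
  case True
  have "trow 0 (jc \<alpha> \<beta> (rdeg F1 F2 n i)) N j
      = Y ^ j * (pderiv ^^ j) (jacobi_poly \<alpha> \<beta> (sorted_list_of_set F1 ! i))"
    using trow_pderiv[of "jc \<alpha> \<beta> (rdeg F1 F2 n i)" N j] jacobi_poly_trow[OF assms(3)] True
    by (simp add: rdeg_def)
  then have t: "trow (rexp F1 F2 \<beta> i) (rcoeff F1 F2 n \<alpha> \<beta> i) N j
      = Y ^ j * (pderiv ^^ j) (jacobi_poly \<alpha> \<beta> (sorted_list_of_set F1 ! i))"
    using True by (simp only: rexp_def rcoeff_def rpar_def if_True)
  have W: "W_mat \<alpha> \<beta> F1 F2 $$ (i, j) =
      smult ((-1) ^ j) ((pderiv ^^ j) (jacobi_poly \<alpha> \<beta> (sorted_list_of_set F1 ! i)))"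
    using True assms by (simp add: W_mat_def Let_def)
  have "smult k D * B = 1 * (B * D) * [:k:]" for k and B D :: "real poly"
    by (simp add: mult.commute)
  then show ?thesis using True by (simp only: t W if_True)
next
  case False
  define f where "f = sorted_list_of_set F2 ! (i - card F1)"
  have f: "rdeg F1 F2 n i = f" using False assms by (simp add: rdeg_def f_def)
  have t: "trow (- \<beta>) (jc \<alpha> (- \<beta>) f) N j = smult ((-1) ^ j * pochhammer (\<beta> - real f) j)
     (jacobi_poly (\<alpha> + real j) (- \<beta> - real j) f)"
    using trow_jacobi[of f N "- \<beta>" \<alpha> j] assms(3) f by simp
  have W: "W_mat \<alpha> \<beta> F1 F2 $$ (i, j) = smult (pochhammer (\<beta> - real f) j)
     (Y ^ (card F1 + card F2 - Suc j) * jacobi_poly (\<alpha> + real j) (- \<beta> - real j) f)"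
    using False assms by (simp add: W_mat_def Let_def f_def)
  have y: "Y ^ (card F1 + card F2 - Suc j) * Y ^ j = Y ^ (card F1 + card F2 - 1)"
    using assms(2) by (simp flip: power_add)
  have r: "trow (rexp F1 F2 \<beta> i) (rcoeff F1 F2 n \<alpha> \<beta> i) N j = trow (- \<beta>) (jc \<alpha> (- \<beta>) f) N j"
    using False assms by (simp add: rexp_def rcoeff_def rpar_def f)
  have c: "smult l J * [:(-1) ^ j:] = smult ((-1) ^ j * l) J" for l :: real and J
    by (simp add: mult.commute)
  have m1: "(-1) ^ j * ((-1) ^ j * l) = (l::real)" for l
    by (simp flip: mult.assoc power_mult_distrib)
  have "smult k (A * J) * B = (A * B) * smult ((-1) ^ j * k) J * [:(-1) ^ j:]" for k and A B J :: "real poly"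
    unfolding mult.assoc[of "A * B"] c m1 by (simp add: mult_ac)
  from this[of "pochhammer (\<beta> - real f) j" "Y ^ (card F1 + card F2 - Suc j)"
      "jacobi_poly (\<alpha> + real j) (- \<beta> - real j) f" "Y ^ j"]
  show ?thesis using False by (simp only: W r t y if_False)
qed

lemma Omega_poly_conv:
  assumes fin: "finite F1" "finite F2" and N: "\<And>f. f \<in> F1 \<union> F2 \<Longrightarrow> f \<le> N"
  shows "\<exists>\<sigma>\<noteq>0. Omega_poly \<alpha> \<beta> F1 F2 = smult \<sigma> (red_omega F1 F2 n N \<alpha> \<beta>)"
proof -
  define k1 k2 k where k: "k1 = card F1" "k2 = card F2" "k = k1 + k2"
  let ?b = "rexp F1 F2 \<beta>" and ?c = "rcoeff F1 F2 n \<alpha> \<beta>"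
  define \<sigma> :: real where "\<sigma> = (\<Prod>j<k. (-1) ^ j)"
  define R where "R = red_omega F1 F2 n N \<alpha> \<beta>"
  have W: "W_mat \<alpha> \<beta> F1 F2 \<in> carrier_mat k k"
    by (simp add: W_mat_def Let_def k)
  have Weq: "Matrix.mat k k (\<lambda>(i, j). W_mat \<alpha> \<beta> F1 F2 $$ (i, j)) = W_mat \<alpha> \<beta> F1 F2"
    using W by (intro eq_matI) auto
  have deg: "rdeg F1 F2 n i \<le> N" if "i < k" for i
    using rdeg_mem[OF fin, of i n] that N k by (cases "i < card F1") auto
  have "Determinant.det (Matrix.mat k k (\<lambda>(i, j). 1 * W_mat \<alpha> \<beta> F1 F2 $$ (i, j) * Y ^ j))
     = Determinant.det (Matrix.mat k k (\<lambda>(i, j). (if i < k1 then 1 else Y ^ (k - 1)) *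
         trow (?b i) (?c i) N j * [:(-1) ^ j:]))"
    by (rule arg_cong[of _ _ Determinant.det], rule eq_matI)
       (use deg in \<open>auto simp only: dim_row_mat dim_col_mat index_mat split_conv mult_1_left
          k W_mat_entry[of _ F1 F2 _ n N]\<close>)
  also have "Determinant.det (Matrix.mat k k (\<lambda>(i, j). 1 * W_mat \<alpha> \<beta> F1 F2 $$ (i, j) * Y ^ j))
     = (\<Prod>j<k. Y ^ j) * Determinant.det (W_mat \<alpha> \<beta> F1 F2)"
    using det_scale[where h = "\<lambda>_. 1" and f = "\<lambda>i j. W_mat \<alpha> \<beta> F1 F2 $$ (i, j)" and g = "\<lambda>j. Y ^ j"
        and K = k]
    by (simp only: prod.neutral_const mult_1_left Weq)
  also have "(\<Prod>j<k. Y ^ j) = Y ^ tri k"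
    unfolding tri_def by (rule power_sum[symmetric])
  also have "Determinant.det (Matrix.mat k k (\<lambda>(i, j). (if i < k1 then 1 else Y ^ (k - 1)) *
         trow (?b i) (?c i) N j * [:(-1) ^ j:]))
     = (\<Prod>i<k. if i < k1 then 1 else Y ^ (k - 1)) * (\<Prod>j<k. [:(-1) ^ j:]) * trow_det k ?b ?c N"
    unfolding trow_det_def
    by (rule det_scale[where h = "\<lambda>i. if i < k1 then 1 else Y ^ (k - 1)" and g = "\<lambda>j. [:(-1) ^ j:]"
          and f = "\<lambda>i j. trow (?b i) (?c i) N j"])
  also have "(\<Prod>i<k. if i < k1 then 1 else Y ^ (k - 1)) = (\<Prod>i\<in>{k1..<k}. Y ^ (k - 1))"
    by (rule prod.mono_neutral_cong_right) auto
  also have "\<dots> = Y ^ ((k - 1) * k2)"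
    by (simp add: k power_mult)
  also have "(\<Prod>j<k. [:(-1) ^ j:]) = [:\<sigma>:]"
    unfolding \<sigma>_def by (induction k) (simp_all add: one_pCons)
  also have "trow_det k ?b ?c N = Y ^ (tri k1 + tri k2) * R"
    unfolding R_def k by (rule trow_det_omega)
  finally have "Y ^ tri k * Determinant.det (W_mat \<alpha> \<beta> F1 F2)
      = Y ^ ((k - 1) * k2) * [:\<sigma>:] * (Y ^ (tri k1 + tri k2) * R)" .
  also have "\<dots> = Y ^ ((k - 1) * k2 + (tri k1 + tri k2)) * smult \<sigma> R"
    by (simp add: power_add mult_ac)
  \<comment> \<open>Beyond the column scaling exactly \<open>k2 * (k2 - 1)\<close> powers of
    \<open>Y\<close> survive, so the division in \<open>Omega_poly\<close> is exact. Truncated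
    subtraction is why \<open>k2 = 0\<close> is treated apart.\<close>
  also have "(k - 1) * k2 + (tri k1 + tri k2) = tri k + k2 * (k2 - 1)"
  proof (cases "k2 = 0")
    case False
    then have "real (k - 1) = real k1 + real k2 - 1" "real (k2 - 1) = real k2 - 1"
      using k by auto
    then have "2 * real ((k - 1) * k2 + (tri k1 + tri k2)) = 2 * real (tri k + k2 * (k2 - 1))"
      using tri_real[of k1] tri_real[of k2] tri_real[of k] unfolding k(3)
      by (simp only: of_nat_add of_nat_mult distrib_left) (simp add: algebra_simps)
    then show ?thesis by (metis mult_cancel_left of_nat_eq_iff zero_neq_numeral)
  qed (simp add: k tri_def)
  finally have "Y ^ tri k * Determinant.det (W_mat \<alpha> \<beta> F1 F2)
      = Y ^ tri k * (Y ^ (k2 * (k2 - 1)) * smult \<sigma> R)"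
    by (simp only: power_add mult.assoc)
  moreover have "Y ^ j \<noteq> 0" for j by simp
  ultimately have "Determinant.det (W_mat \<alpha> \<beta> F1 F2) = Y ^ (k2 * (k2 - 1)) * smult \<sigma> R"
    using mult_left_cancel by blast
  then have "Omega_poly \<alpha> \<beta> F1 F2 = smult \<sigma> R"
    unfolding Omega_poly_def k(2)[symmetric]
    by (simp only: nonzero_mult_div_cancel_left[OF \<open>\<And>j. Y ^ j \<noteq> 0\<close>])
  moreover have "\<sigma> \<noteq> 0" by (simp add: \<sigma>_def)
  ultimately show ?thesis unfolding R_def by blast
qed

subsection \<open>Antiderivatives of weighted rational functions\<close>

lemma factor_endpoints:
  fixes A :: "real poly"
  assumes "A \<noteq> 0"
  obtains i j q where "A = Y ^ i * Z ^ j * q" "poly q 1 \<noteq> 0" "poly q (-1) \<noteq> 0"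
proof -
  obtain q1 where q1: "A = [:- (-1), 1:] ^ order (-1) A * q1" "\<not> [:- (-1), 1:] dvd q1"
    using order_decomp[OF assms] by blast
  define i where "i = order (-1) A"
  have A: "A = Y ^ i * q1" using q1(1) by (simp add: i_def)
  have "q1 \<noteq> 0" using A assms by auto
  then obtain q2 where q2: "q1 = [:-1, 1:] ^ order 1 q1 * q2" "\<not> [:-1, 1:] dvd q2"
    using order_decomp by blast
  define j where "j = order 1 q1"
  have "([:-1, 1:] :: real poly) = smult (-1) Z" by simp
  then have "([:-1, 1:] :: real poly) ^ j = smult ((-1) ^ j) (Z ^ j)" by (simp only: smult_power)
  then have "A = Y ^ i * Z ^ j * smult ((-1) ^ j) q2"
    using A q2(1) by (simp add: j_def mult_smult_right mult_ac)
  moreover have "poly (smult ((-1) ^ j) q2) 1 \<noteq> 0"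
    using q2(2) by (simp add: poly_eq_0_iff_dvd)
  moreover have "poly (smult ((-1) ^ j) q2) (-1) \<noteq> 0"
  proof -
    have "poly q1 (-1) \<noteq> 0" using q1(2) by (simp add: poly_eq_0_iff_dvd)
    then show ?thesis using q2(1) by (metis mult_zero_right no_zero_divisors poly_mult poly_smult power_not_zero zero_neq_neg_one)
  qed
  ultimately show ?thesis using that by blast
qed

text \<open>The orders of \<open>R\<close> at both ends stay explicit: at -1 and 1 the last factor
  reduces to a multiple of the total exponent there.\<close>

lemma weighted_deriv_factored:
  fixes A B :: "real poly"
  assumes B: "B \<noteq> 0"
    and R: "R * to_fract (Y ^ i' * Z ^ j' * B) = to_fract (Y ^ i * Z ^ j * A)"
  shows "(fract_deriv R + (cst \<beta> / to_fract Y - cst \<alpha> / to_fract Z) * R)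
      * to_fract (Y ^ Suc i' * Z ^ Suc j' * B\<^sup>2) =
    to_fract (Y ^ i * Z ^ j * (Y * Z * (pderiv A * B - A * pderiv B) +
      A * B * (smult (real i - real i' + \<beta>) Z - smult (real j - real j' + \<alpha>) Y)))"
proof -
  define y z a b where "y = to_fract Y" and "z = to_fract Z" and "a = to_fract A" and "b = to_fract B"
  have nz: "y \<noteq> 0" "z \<noteq> 0" "b \<noteq> 0" using B by (simp_all add: y_def z_def b_def)
  have dy: "fract_deriv y = 1" and dz: "fract_deriv z = -1"
    unfolding y_def z_def fract_deriv_to_fract pderiv_Y pderiv_Z by simp_all
  have pw: "of_nat n * x ^ (n - 1) * x = of_nat n * x ^ n" for n and x :: "real poly fract"
    by (cases n) simp_all
  have dprod: "y * z * fract_deriv (y ^ m * z ^ l * c) =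
      y ^ m * z ^ l * (of_nat m * z * c - of_nat l * y * c + y * z * fract_deriv c)" for m l c
  proof -
    have "y * z * fract_deriv (y ^ m * z ^ l * c) =
       (of_nat m * y ^ (m - 1) * y) * z ^ l * z * c - y ^ m * (of_nat l * z ^ (l - 1) * z) * y * c
       + y ^ m * z ^ l * (y * z * fract_deriv c)"
      by (simp add: fd.d_mult fd.d_power dy dz algebra_simps)
    then show ?thesis unfolding pw by (simp add: algebra_simps)
  qed
  define P where "P = y ^ i * z ^ j * a"
  define Q where "Q = y ^ i' * z ^ j' * b"
  have RQ: "R * Q = P"
    using R by (simp only: P_def Q_def y_def z_def a_def b_def to_fract_mult to_fract_power)
  have dR: "fract_deriv R * Q = fract_deriv P - R * fract_deriv Q"
    unfolding RQ[symmetric] fd.d_mult by simp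
  have "(fract_deriv R + (cst \<beta> / y - cst \<alpha> / z) * R) * (y * z * b * Q)
     = b * (y * z * (fract_deriv R * Q)) + b * (cst \<beta> * z - cst \<alpha> * y) * (R * Q)"
    using nz by (simp add: field_simps)
  also have "\<dots> = b * (y * z * fract_deriv P) - R * (b * (y * z * fract_deriv Q))
      + b * (cst \<beta> * z - cst \<alpha> * y) * P"
    unfolding dR RQ by (simp add: algebra_simps)
  also have "R * (b * (y * z * fract_deriv Q))
      = R * Q * (of_nat i' * z * b - of_nat j' * y * b + y * z * fract_deriv b)"
    unfolding Q_def dprod by (simp add: algebra_simps)
  also have "b * (y * z * fract_deriv P) - \<dots> + b * (cst \<beta> * z - cst \<alpha> * y) * P
      = y ^ i * z ^ j * (y * z * (fract_deriv a * b - a * fract_deriv b) +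
         a * b * (cst (real i - real i' + \<beta>) * z - cst (real j - real j' + \<alpha>) * y))"
    unfolding RQ unfolding P_def dprod
    by (simp add: cst_add cst_diff cst_of_nat algebra_simps)
  finally show ?thesis
    unfolding y_def z_def a_def b_def Q_def
    by (simp only: to_fract_mult to_fract_power to_fract_add to_fract_diff to_fract_smult
        fract_deriv_to_fract power2_eq_square power_Suc mult_ac)
qed

text \<open>Since \<open>\<alpha>\<close> and \<open>\<beta>\<close> are not integers, differentiation lowers the order of
  \<open>(1 - x)\<^sup>\<alpha> (1 + x)\<^sup>\<beta> R\<close> at \<open>\<plusminus>1\<close> by exactly one, and it raises the order of a pole inside the
  interval. Hence an antiderivative with integrable derivative is continuous on \<open>[-1, 1]\<close>, vanishes
  at both ends, and Rolle's theorem applies.\<close>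

lemma exact_imp_zero:
  fixes N E :: "real poly"
  assumes \<alpha>: "\<alpha> \<notin> \<int>" and \<beta>: "\<beta> \<notin> \<int>"
    and ex: "fd.exact (cst \<beta> / to_fract Y - cst \<alpha> / to_fract Z) G"
    and G: "G * to_fract (Y ^ e * E) = to_fract (Z ^ a * Y ^ b * N)"
    and E: "\<And>x. x \<in> {-1..1} \<Longrightarrow> poly E x \<noteq> 0"
    and a: "\<alpha> + real a > -1" and b: "\<beta> + real b - real e > -1"
  shows "\<exists>x. -1 < x \<and> x < 1 \<and> poly N x = 0"
proof -
  obtain R where R: "G = fract_deriv R + (cst \<beta> / to_fract Y - cst \<alpha> / to_fract Z) * R"
    using ex unfolding fd.exact_def by blast
  obtain A B where AB: "R = to_fract A / to_fract B" "B \<noteq> 0" "coprime A B"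
    by (rule fract_cases)
  show ?thesis
  proof (cases "A = 0")
    case True
    then have "to_fract (Z ^ a * Y ^ b * N) = 0"
      using G R AB by simp
    then have "N = 0" by (simp del: to_fract_mult)
    then show ?thesis by (intro exI[of _ 0]) simp
  next
    case False
    obtain i j A1 where A1: "A = Y ^ i * Z ^ j * A1" "poly A1 1 \<noteq> 0" "poly A1 (-1) \<noteq> 0"
      by (rule factor_endpoints[OF False])
    obtain i' j' B1 where B1: "B = Y ^ i' * Z ^ j' * B1" "poly B1 1 \<noteq> 0" "poly B1 (-1) \<noteq> 0"
      by (rule factor_endpoints[OF AB(2)])
    have B1nz: "B1 \<noteq> 0" using B1 by auto
    define r where "r = real i - real i' + \<beta>"
    define s where "s = real j - real j' + \<alpha>"
    have r: "r \<noteq> 0"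
    proof
      assume "r = 0"
      then have "\<beta> = of_int (int i' - int i)" by (simp add: r_def)
      then show False using \<beta> by auto
    qed
    have s: "s \<noteq> 0"
    proof
      assume "s = 0"
      then have "\<alpha> = of_int (int j' - int j)" by (simp add: s_def)
      then show False using \<alpha> by auto
    qed
    define \<Phi> where "\<Phi> = Y * Z * (pderiv A1 * B1 - A1 * pderiv B1) + A1 * B1 * (smult r Z - smult s Y)"
    have "R * to_fract (Y ^ i' * Z ^ j' * B1) = to_fract (Y ^ i * Z ^ j * A1)"
      unfolding AB(1) A1(1)[symmetric] B1(1)[symmetric] using AB(2) by simp
    then have GB: "G * to_fract (Y ^ Suc i' * Z ^ Suc j' * B1\<^sup>2) = to_fract (Y ^ i * Z ^ j * \<Phi>)"
      unfolding R \<Phi>_def r_def s_def by (rule weighted_deriv_factored[OF B1nz])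
    have "to_fract (Y ^ i * Z ^ j * \<Phi>) * to_fract (Y ^ e * E)
        = to_fract (Z ^ a * Y ^ b * N) * to_fract (Y ^ Suc i' * Z ^ Suc j' * B1\<^sup>2)"
      unfolding GB[symmetric] G[symmetric] by (simp only: mult_ac)
    then have "to_fract ((Y ^ i * Z ^ j * \<Phi>) * (Y ^ e * E))
        = to_fract ((Z ^ a * Y ^ b * N) * (Y ^ Suc i' * Z ^ Suc j' * B1\<^sup>2))"
      by (simp only: to_fract_mult)
    then have "(Y ^ i * Z ^ j * \<Phi>) * (Y ^ e * E) = (Z ^ a * Y ^ b * N) * (Y ^ Suc i' * Z ^ Suc j' * B1\<^sup>2)"
      by (simp only: to_fract_eq_iff)
    then have key: "Y ^ (i + e) * Z ^ j * (\<Phi> * E) = Y ^ (Suc i' + b) * Z ^ (Suc j' + a) * (B1\<^sup>2 * N)"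
      by (simp only: power_add mult_ac)
    have ev: "poly Y x = 1 + x" "poly Z x = 1 - x" for x by simp_all
    have \<Phi>m: "poly \<Phi> (-1) \<noteq> 0" and \<Phi>p: "poly \<Phi> 1 \<noteq> 0"
    proof -
      have "poly \<Phi> (-1) = 2 * r * poly A1 (-1) * poly B1 (-1)" "poly \<Phi> 1 = -2 * s * poly A1 1 * poly B1 1"
        by (simp_all add: \<Phi>_def algebra_simps)
      then show "poly \<Phi> (-1) \<noteq> 0" "poly \<Phi> 1 \<noteq> 0" using A1 B1 r s by simp_all
    qed
    \<comment> \<open>At -1 the left side of \<open>key\<close> has order exactly
      \<open>i + e\<close>, as \<Phi> and \<open>E\<close> do not vanish there.\<close>
    have le1: "Suc i' + b \<le> i + e"
    proof (rule ccontr)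
      assume "\<not> ?thesis"
      then obtain m where m: "Suc i' + b = (i + e) + Suc m"
        by (metis add_Suc_right less_imp_Suc_add not_le_imp_less)
      have "Y ^ (i + e) * (Z ^ j * (\<Phi> * E)) = Y ^ (i + e) * (Y ^ Suc m * Z ^ (Suc j' + a) * (B1\<^sup>2 * N))"
        using key unfolding m by (simp only: power_add mult_ac)
      then have "Z ^ j * (\<Phi> * E) = Y ^ Suc m * Z ^ (Suc j' + a) * (B1\<^sup>2 * N)"
        by (rule mult_left_cancel[THEN iffD1, rotated]) simp
      then have "poly (Z ^ j * (\<Phi> * E)) (-1) = poly (Y ^ Suc m * Z ^ (Suc j' + a) * (B1\<^sup>2 * N)) (-1)"
        by (rule arg_cong)
      then show False using \<Phi>m E[of "-1"] by (simp add: ev)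
    qed
    have le2: "Suc j' + a \<le> j"
    proof (rule ccontr)
      assume "\<not> ?thesis"
      then obtain m where m: "Suc j' + a = j + Suc m"
        by (metis add_Suc_right less_imp_Suc_add not_le_imp_less)
      have "Z ^ j * (Y ^ (i + e) * (\<Phi> * E)) = Z ^ j * (Z ^ Suc m * Y ^ (Suc i' + b) * (B1\<^sup>2 * N))"
        using key unfolding m by (simp only: power_add mult_ac)
      then have "Y ^ (i + e) * (\<Phi> * E) = Z ^ Suc m * Y ^ (Suc i' + b) * (B1\<^sup>2 * N)"
        by (rule mult_left_cancel[THEN iffD1, rotated]) simp
      then have "poly (Y ^ (i + e) * (\<Phi> * E)) 1 = poly (Z ^ Suc m * Y ^ (Suc i' + b) * (B1\<^sup>2 * N)) 1"
        by (rule arg_cong)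
      then show False using \<Phi>p E[of 1] by (simp add: ev)
    qed
    \<comment> \<open>The order bounds give \<open>r \<ge> 1 + \<beta> + b - e\<close> and
      \<open>s \<ge> 1 + \<alpha> + a\<close>, positive by the integrability hypotheses.\<close>
    have r0: "r > 0" and s0: "s > 0"
      using le1 le2 a b unfolding r_def s_def by linarith+
    \<comment> \<open>By \<open>key\<close>, \<open>B1\<close> divides \<open>q * pderiv B1\<close>
      with \<open>q\<close> nonzero at \<open>x\<close>; but the order of a zero drops under
      differentiation. So \<open>R\<close> has no pole inside.\<close>
    have inner: "poly B1 x \<noteq> 0" if x: "-1 < x" "x < 1" for x
    proof
      assume B0: "poly B1 x = 0"
      define m where "m = order x B1"
      have "poly B x = 0" using B0 by (simp add: B1(1))
      have "poly A x \<noteq> 0"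
      proof
        assume "poly A x = 0"
        then have "[:- x, 1:] dvd A" "[:- x, 1:] dvd B"
          using \<open>poly B x = 0\<close> by (simp_all add: poly_eq_0_iff_dvd)
        then have "is_unit [:- x, 1:]" using AB(3) coprime_common_divisor by blast
        then show False by (simp add: is_unit_iff_degree)
      qed
      then have A0: "poly A1 x \<noteq> 0" by (simp add: A1(1))
      define q where "q = Y ^ (i + e) * Z ^ j * (Y * Z) * A1 * E"
      have "B1 dvd Y ^ (i + e) * Z ^ j * (\<Phi> * E)"
        unfolding key by (simp add: power2_eq_square dvd_mult)
      moreover have "q * pderiv B1 =
          B1 * (Y ^ (i + e) * Z ^ j * E * (Y * Z * pderiv A1 + A1 * (smult r Z - smult s Y)))
          - Y ^ (i + e) * Z ^ j * (\<Phi> * E)"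
      proof -
        have "U * V * W * A1 * E * D = B1 * (U * V * E * (W * D' + A1 * F))
            - U * V * ((W * (D' * B1 - A1 * D) + A1 * B1 * F) * E)" for U V W D D' F
          by (simp add: algebra_simps)
        then show ?thesis unfolding \<Phi>_def q_def by blast
      qed
      ultimately have dvd: "B1 dvd q * pderiv B1"
        by (simp only: dvd_diff dvd_triv_left)
      have qx: "poly q x \<noteq> 0"
        unfolding q_def poly_mult poly_power ev using x A0 E[of x] by simp
      have B': "pderiv B1 \<noteq> 0"
      proof
        assume "pderiv B1 = 0"
        then obtain c where "B1 = [:c:]" using pderiv_iszero by blast
        then show False using B0 B1nz by auto
      qed
      have nz: "q * pderiv B1 \<noteq> 0" using qx B' by auto
      have "order x B1 \<le> order x (q * pderiv B1)"
        using dvd_imp_order_le[OF nz dvd] .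
      also have "\<dots> = order x (pderiv B1)"
        using order_mult[OF nz] order_0I[OF qx] by simp
      finally show False using order_pderiv[OF B1nz B0] by simp
    qed
    \<comment> \<open>This is the weight times \<open>R\<close>, with the orders of \<open>R\<close>
      at the ends absorbed into the exponents.\<close>
    define f where "f x = (1 - x) powr s * (1 + x) powr r * (poly A1 x / poly B1 x)" for x
    define f' where "f' x = (1 - x) powr (s - 1) * (1 + x) powr (r - 1) * (poly \<Phi> x / (poly B1 x)\<^sup>2)" for x
    have B1cl: "poly B1 x \<noteq> 0" if "x \<in> {-1..1}" for x
      using inner[of x] B1 that by (cases "x = -1 \<or> x = 1") auto
    have cont: "continuous_on {-1..1} f"
      unfolding f_def using r0 s0 B1cl by (intro continuous_intros continuous_on_powr') auto
    have der: "(f has_real_derivative f' x) (at x)" if x: "-1 < x" "x < 1" for x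
    proof -
      define u v where "u = (1 - x) powr (s - 1)" and "v = (1 + x) powr (r - 1)"
      have u: "(1 - x) powr s = u * (1 - x)" and v: "(1 + x) powr r = v * (1 + x)"
        using x by (simp_all add: u_def v_def powr_diff)
      have "(f has_real_derivative
          (- s * u) * (v * (1 + x)) * (poly A1 x / poly B1 x)
          + (u * (1 - x)) * (r * v) * (poly A1 x / poly B1 x)
          + (u * (1 - x)) * (v * (1 + x)) *
            ((poly (pderiv A1) x * poly B1 x - poly A1 x * poly (pderiv B1) x) / (poly B1 x * poly B1 x))) (at x)"
      proof -
        have 1: "((\<lambda>x. (1 - x) powr s) has_real_derivative - s * u) (at x)"
          unfolding u_def using x by (auto intro!: derivative_eq_intros)
        have 2: "((\<lambda>x. (1 + x) powr r) has_real_derivative r * v) (at x)"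
          unfolding v_def using x by (auto intro!: derivative_eq_intros)
        have 3: "((\<lambda>x. poly A1 x / poly B1 x) has_real_derivative
            (poly (pderiv A1) x * poly B1 x - poly A1 x * poly (pderiv B1) x) / (poly B1 x * poly B1 x)) (at x)"
          by (rule DERIV_divide) (use poly_DERIV inner[OF x] in auto)
        show ?thesis
          unfolding f_def using DERIV_mult[OF DERIV_mult[OF 1 2] 3]
          by (simp add: u v algebra_simps)
      qed
      moreover have "(- s * u) * (v * (1 + x)) * (poly A1 x / poly B1 x)
          + (u * (1 - x)) * (r * v) * (poly A1 x / poly B1 x)
          + (u * (1 - x)) * (v * (1 + x)) *
            ((poly (pderiv A1) x * poly B1 x - poly A1 x * poly (pderiv B1) x) / (poly B1 x * poly B1 x))
          = f' x"
      proof -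
        have "poly \<Phi> x = (1 + x) * (1 - x) * (poly (pderiv A1) x * poly B1 x - poly A1 x * poly (pderiv B1) x)
            + poly A1 x * poly B1 x * (r * (1 - x) - s * (1 + x))"
          by (simp add: \<Phi>_def algebra_simps)
        then show ?thesis
          using inner[OF x] unfolding f'_def u_def[symmetric] v_def[symmetric]
          by (simp add: divide_simps power2_eq_square) (simp add: algebra_simps)
      qed
      ultimately show ?thesis by simp
    qed
    have "f (-1) = f 1" using r0 s0 by (simp add: f_def)
    then obtain x where x: "-1 < x" "x < 1" and "(\<lambda>v. v * f' x) = (\<lambda>v. 0)"
      using Rolle_deriv[of "-1" 1 f "\<lambda>x v. v * f' x"] cont der
      by (auto simp: has_field_derivative_def mult.commute[of _ "f' _"])
    then have "f' x = 0" by (metis mult_1)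
    then have "poly \<Phi> x = 0" using x inner[OF x] by (auto simp: f'_def)
    moreover have "poly (Y ^ (i + e) * Z ^ j * (\<Phi> * E)) x = poly (Y ^ (Suc i' + b) * Z ^ (Suc j' + a) * (B1\<^sup>2 * N)) x"
      unfolding key ..
    ultimately have "poly N x = 0" using x inner[OF x]
      unfolding poly_mult poly_power ev by simp
    then show ?thesis using x by blast
  qed
qed

subsection \<open>The regularised norm of Jacobi polynomials\<close>

text \<open>\<open>jp\<close> is \<open>1 - x^2\<close>, \<open>jr\<close> the first-order
  coefficient of the Jacobi operator, and \<open>jw\<close> the logarithmic derivative of the
  weight.\<close>

definition jp :: "real poly fract" where "jp = to_fract (Y * Z)"
definition jr :: "real \<Rightarrow> real \<Rightarrow> real poly fract" where
  "jr \<alpha> \<beta> = cst (2 * \<beta> + 2) - cst (\<alpha> + \<beta> + 2) * to_fract Y"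
definition jw :: "real \<Rightarrow> real \<Rightarrow> real poly fract" where
  "jw \<alpha> \<beta> = cst \<beta> / to_fract Y - cst \<alpha> / to_fract Z"

lemma jr_eq: "jr \<alpha> \<beta> = fract_deriv jp + jp * jw \<alpha> \<beta>"
  unfolding jr_def jp_def jw_def by (rule omega_relation)

lemma jp_deriv: "fract_deriv jp = to_fract Z - to_fract Y"
  unfolding jp_def fract_deriv_to_fract pderiv_mult pderiv_Y pderiv_Z
  by (simp only: to_fract_add to_fract_mult to_fract_uminus to_fract_1)

definition eigv :: "real \<Rightarrow> real \<Rightarrow> nat \<Rightarrow> real" where
  "eigv \<alpha> \<beta> n = real n * (real n + \<alpha> + \<beta> + 1)"

lemma jacobi_eigenfun:
  "fd.eigenfun jp (jr \<alpha> \<beta>) 0 0 (to_fract (jacobi_poly \<alpha> \<beta> n)) (cst (eigv \<alpha> \<beta> n))"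
proof -
  have "fd.eigenfun jp (jr \<alpha> \<beta>) 0 (cst 0 / to_fract Y)
      (to_fract (trow 0 (jc \<alpha> \<beta> n) n 0)) (cst (eigv \<alpha> \<beta> n))"
    unfolding jp_def jr_def
  proof (rule trow_eigenfun)
    fix m
    show "2 * (real m + 1 + 0) * (real m + 1 + 0 + \<beta>) * jc \<alpha> \<beta> n (Suc m)
      = - (eigv \<alpha> \<beta> n - (real m + 0) * (real m + 0 + \<alpha> + \<beta> + 1)) * jc \<alpha> \<beta> n m"
      using jc_rec[of m \<beta> \<alpha> n] by (simp add: eigv_def algebra_simps)
  qed (simp_all add: jc_def)
  then show ?thesis by (simp add: jacobi_poly_trow)
qed

text \<open>The exponent \<open>- \<beta>\<close> solves the indicial equation too: the same
  operator has these eigenfunctions with prefactor \<open>(1 + x)^(- \<beta>)\<close>.\<close>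

lemma jacobi_eigenfun_twisted:
  "fd.eigenfun jp (jr \<alpha> \<beta>) 0 (cst (- \<beta>) / to_fract Y) (to_fract (jacobi_poly \<alpha> (- \<beta>) n))
     (cst ((real n - \<beta>) * (real n + \<alpha> + 1)))"
proof -
  have "fd.eigenfun jp (jr \<alpha> \<beta>) 0 (cst (- \<beta>) / to_fract Y)
      (to_fract (trow (- \<beta>) (jc \<alpha> (- \<beta>) n) n 0)) (cst ((real n - \<beta>) * (real n + \<alpha> + 1)))"
    unfolding jp_def jr_def
  proof (rule trow_eigenfun)
    fix m
    show "2 * (real m + 1 + - \<beta>) * (real m + 1 + - \<beta> + \<beta>) * jc \<alpha> (- \<beta>) n (Suc m)
      = - ((real n - \<beta>) * (real n + \<alpha> + 1) - (real m + - \<beta>) * (real m + - \<beta> + \<alpha> + \<beta> + 1))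
          * jc \<alpha> (- \<beta>) n m"
      using jc_rec[of m "- \<beta>" \<alpha> n] by (simp add: algebra_simps)
  qed (simp_all add: jc_def)
  then show ?thesis by (simp add: jacobi_poly_trow)
qed

text \<open>The derivatives of a Jacobi polynomial are again eigenfunctions: this is the Darboux step with
  constant seed. After \<open>n\<close> steps only a constant is left.\<close>

lemma jacobi_square_exact_pderiv:
  assumes "j \<le> n"
  shows "fd.exact (jw \<alpha> \<beta>) (jp ^ j * (to_fract ((pderiv ^^ j) (jacobi_poly \<alpha> \<beta> n)))\<^sup>2
     - cst (\<Prod>i<j. eigv \<alpha> \<beta> n - eigv \<alpha> \<beta> i) * (to_fract (jacobi_poly \<alpha> \<beta> n))\<^sup>2)"
proof -
  define u where "u j = to_fract ((pderiv ^^ j) (jacobi_poly \<alpha> \<beta> n))" for j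
  have du: "fract_deriv (u j) = u (Suc j)" for j by (simp add: u_def)
  let ?r = "\<lambda>j. jr \<alpha> \<beta> + of_nat j * fract_deriv jp"
  have dr: "fract_deriv (?r j) = cst (- (\<alpha> + \<beta> + 2) - 2 * real j)" for j
  proof -
    have "fract_deriv (?r j) = - cst (\<alpha> + \<beta> + 2) * fract_deriv (to_fract Y)
        + of_nat j * (fract_deriv (to_fract Z) - fract_deriv (to_fract Y))"
      unfolding jr_def jp_deriv
      using cst_simps(3)[of "of_nat j"] by (simp add: fd.d_add fd.d_diff fd.d_mult flip: cst_of_nat)
    also have "\<dots> = - cst (\<alpha> + \<beta> + 2) + of_nat j * (- 2)"
      unfolding fract_deriv_to_fract pderiv_Y pderiv_Z by simp
    also have "\<dots> = cst (- (\<alpha> + \<beta> + 2) - 2 * real j)"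
      unfolding cst_diff cst_minus cst_mult cst_of_nat cst_numeral by simp
    finally show ?thesis .
  qed
  have eig: "fd.eigenfun jp (?r j) (- cst (eigv \<alpha> \<beta> j)) 0 (u j) (cst (eigv \<alpha> \<beta> n))" for j
  proof (induction j)
    case 0
    show ?case using jacobi_eigenfun[of \<alpha> \<beta> n] by (simp add: u_def eigv_def)
  next
    case (Suc j)
    \<comment> \<open>For the constant seed \<sigma> is 0, and the Riccati equation says that
      \<open>cst (eigv \<alpha> \<beta> j)\<close> cancels the zeroth-order coefficient.\<close>
    have "fd.eigenfun jp (?r j + fract_deriv jp)
        (fract_deriv (?r j + jp * 0) - 0 * (?r j + jp * 0) - cst (eigv \<alpha> \<beta> j)) 0
        (fd.tw 0 (u j) - 0 * u j) (cst (eigv \<alpha> \<beta> n))"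
      by (rule fd.darboux_eigenfun[OF _ Suc]) simp_all
    moreover have "cst (- (\<alpha> + \<beta> + 2) - 2 * real j) - cst (eigv \<alpha> \<beta> j) = - cst (eigv \<alpha> \<beta> (Suc j))"
      by (simp add: eigv_def algebra_simps flip: cst_diff cst_minus)
    moreover have "?r j + fract_deriv jp = ?r (Suc j)" by (simp add: algebra_simps)
    ultimately show ?case by (simp add: dr du)
  qed
  have "fd.exact (jw \<alpha> \<beta>) (jp ^ j * (u j)\<^sup>2
     - cst (\<Prod>i<j. eigv \<alpha> \<beta> n - eigv \<alpha> \<beta> i) * (u 0)\<^sup>2)" for j
  proof (induction j)
    case (Suc j)
    define C where "C = (\<Prod>i<j. eigv \<alpha> \<beta> n - eigv \<alpha> \<beta> i)"
    define l where "l = eigv \<alpha> \<beta> n - eigv \<alpha> \<beta> j"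
    have "fd.exact (jw \<alpha> \<beta>) (jp ^ Suc j * (fract_deriv (u j) - 0 * u j)\<^sup>2
        - (cst (eigv \<alpha> \<beta> n) - cst (eigv \<alpha> \<beta> j)) * (jp ^ j * (u j)\<^sup>2))"
      by (rule fd.darboux_norm_step[OF _ eig]) (simp_all add: jr_eq)
    then have 1: "fd.exact (jw \<alpha> \<beta>) (jp ^ Suc j * (u (Suc j))\<^sup>2 - cst l * (jp ^ j * (u j)\<^sup>2))"
      by (simp add: du l_def cst_diff)
    have 2: "fd.exact (jw \<alpha> \<beta>) (cst l * (jp ^ j * (u j)\<^sup>2 - cst C * (u 0)\<^sup>2))"
      unfolding C_def by (rule fd.exact_cmult[OF _ Suc]) simp
    have "fd.exact (jw \<alpha> \<beta>) (jp ^ Suc j * (u (Suc j))\<^sup>2 - cst (C * l) * (u 0)\<^sup>2)"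
      using fd.exact_add[OF 1 2] by (simp add: cst_mult algebra_simps)
    then show ?case unfolding C_def l_def by (simp only: prod.lessThan_Suc)
  qed simp
  from this[of j] show ?thesis by (simp add: u_def)
qed

lemma jacobi_pderiv_top: "(pderiv ^^ n) (jacobi_poly \<alpha> \<beta> n) = [:fact n * jc \<alpha> \<beta> n n:]"
proof -
  have f0: "ffact (real m) n = 0" if "m < n" for m
    using that by (auto simp: ffact_def)
  have fn: "ffact (real n) n = fact n"
  proof -
    have "ffact (real n) n = (\<Prod>i = 0..<n. real n - real i)"
      by (simp add: ffact_def lessThan_atLeast0)
    also have "\<dots> = fact n * (real n gchoose n)"
      by (simp add: gbinomial_mult_fact)
    also have "\<dots> = fact n" by (simp flip: binomial_gbinomial)
    finally show ?thesis .
  qed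
  have "Y ^ n * (pderiv ^^ n) (jacobi_poly \<alpha> \<beta> n) = trow 0 (jc \<alpha> \<beta> n) n n"
    unfolding trow_pderiv[of _ _ n] by (simp add: jacobi_poly_trow)
  also have "\<dots> = (\<Sum>m\<in>{n}. smult (jc \<alpha> \<beta> n m * ffact (real m) n) (Y ^ m))"
    unfolding trow_def by (rule sum.mono_neutral_cong_right) (auto simp: f0)
  also have "\<dots> = Y ^ n * [:fact n * jc \<alpha> \<beta> n n:]"
    by (simp add: fn mult.commute)
  finally show ?thesis by (rule mult_left_cancel[THEN iffD1, rotated]) simp
qed

text \<open>The constant is formally the ratio of the beta integrals of \<open>(1 - x^2)^n\<close>
  and \<open>(1 - x^2)^(n + 1)\<close> against the weight; no convergence is required.\<close>

lemma jp_power_exact: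
  assumes "\<alpha> + real n + 1 \<noteq> 0" "\<beta> + real n + 1 \<noteq> 0"
  shows "fd.exact (jw \<alpha> \<beta>) (jp ^ n - cst ((\<alpha> + \<beta> + 2 * real n + 2) * (\<alpha> + \<beta> + 2 * real n + 3)
      / (4 * (\<alpha> + real n + 1) * (\<beta> + real n + 1))) * jp ^ Suc n)"
proof -
  define a b where "a = \<alpha> + real n + 1" and "b = \<beta> + real n + 1"
  have ab: "a \<noteq> 0" "b \<noteq> 0" using assms by (simp_all add: a_def b_def)
  define y z where "y = to_fract Y" and "z = to_fract Z"
  have nz: "y \<noteq> 0" "z \<noteq> 0" by (simp_all add: y_def z_def)
  have jp: "jp = y * z" by (simp add: jp_def y_def z_def del: mult_pCons_left mult_pCons_right)
  have dy: "fract_deriv y = 1" and dz: "fract_deriv z = -1"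
    unfolding y_def z_def fract_deriv_to_fract pderiv_Y pderiv_Z by simp_all
  have "Y + Z = [:2:]" by simp
  then have "y + z = cst 2" unfolding y_def z_def cst_def to_fract_add[symmetric] by simp
  then have yz: "y + z = 2" by (simp add: cst_numeral)
  define A B where "A = cst a" and "B = cst b"
  have AB: "A \<noteq> 0" "B \<noteq> 0" using ab by (simp_all add: A_def B_def)
  have dA: "fract_deriv A = 0" "fract_deriv B = 0" by (simp_all add: A_def B_def)
  have dinv: "fract_deriv (z / B) = - 1 / B" "fract_deriv (y / A) = 1 / A"
  proof -
    have "fract_deriv (cst (1 / b) * z) = - cst (1 / b)" "fract_deriv (cst (1 / a) * y) = cst (1 / a)"
      by (simp_all add: fd.d_mult dy dz)
    then show "fract_deriv (z / B) = - 1 / B" "fract_deriv (y / A) = 1 / A"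
      by (simp_all add: cst_divide A_def B_def)
  qed
  \<comment> \<open>The two terms are weighted so that the squares in the derivative complete to
    \<open>(y + z)^2 = 4\<close>, which leaves a multiple of \<open>jp\<close>.\<close>
  define g where "g = z / B - y / A"
  have dg: "fract_deriv g = - 1 / B - 1 / A"
    unfolding g_def fd.d_diff dinv by simp
  have jpw: "jp * jw \<alpha> \<beta> = cst \<beta> * z - cst \<alpha> * y"
    unfolding jp jw_def y_def[symmetric] z_def[symmetric] using nz by (simp add: field_simps)
  have AB': "A = cst \<alpha> + of_nat n + 1" "B = cst \<beta> + of_nat n + 1"
    by (simp_all add: A_def B_def a_def b_def cst_add cst_of_nat)
  have "fract_deriv (jp ^ Suc n * g) + jw \<alpha> \<beta> * (jp ^ Suc n * g)
      = jp ^ n * (jp * fract_deriv g + ((of_nat n + 1) * fract_deriv jp + jp * jw \<alpha> \<beta>) * g)"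
    unfolding fd.d_mult fd.d_power by (simp add: algebra_simps)
  also have "jp * fract_deriv g + ((of_nat n + 1) * fract_deriv jp + jp * jw \<alpha> \<beta>) * g
      = y * z * (- 1 / B - 1 / A) + (B * z - A * y) * (z / B - y / A)"
    unfolding jpw dg unfolding g_def jp_deriv unfolding jp AB' y_def[symmetric] z_def[symmetric]
    by (simp add: algebra_simps)
  also have "\<dots> = (y + z)\<^sup>2 - (A + B) * (A + B + 1) / (A * B) * (y * z)"
    using AB by (simp add: field_simps power2_eq_square)
  also have "\<dots> = 4 * (1 - cst ((a + b) * (a + b + 1) / (4 * a * b)) * jp)"
    unfolding yz jp using ab by (simp add: cst_divide cst_mult cst_add cst_numeral A_def B_def mult.assoc field_simps)
  finally have "fract_deriv (jp ^ Suc n * g) + jw \<alpha> \<beta> * (jp ^ Suc n * g)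
      = 4 * (jp ^ n - cst ((a + b) * (a + b + 1) / (4 * a * b)) * jp ^ Suc n)"
    by (simp add: algebra_simps)
  then have "fd.exact (jw \<alpha> \<beta>) (4 * (jp ^ n - cst ((a + b) * (a + b + 1) / (4 * a * b)) * jp ^ Suc n))"
    unfolding fd.exact_def by metis
  then have "fd.exact (jw \<alpha> \<beta>) (cst (1 / 4) * (4 * (jp ^ n - cst ((a + b) * (a + b + 1) / (4 * a * b)) * jp ^ Suc n)))"
    by (rule fd.exact_cmult[rotated]) simp
  moreover have "cst (1 / 4) * (4 * x) = x" for x
    by (simp add: cst_divide cst_numeral)
  moreover have "a + b = \<alpha> + \<beta> + 2 * real n + 2" "a + b + 1 = \<alpha> + \<beta> + 2 * real n + 3"
    by (simp_all add: a_def b_def)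
  ultimately show ?thesis unfolding a_def b_def by (simp only:)
qed

definition beta_ratio :: "real \<Rightarrow> real \<Rightarrow> nat \<Rightarrow> real" where
  "beta_ratio \<alpha> \<beta> m = (\<alpha> + \<beta> + 2 * real m + 2) * (\<alpha> + \<beta> + 2 * real m + 3)
      / (4 * (\<alpha> + real m + 1) * (\<beta> + real m + 1))"

lemma jp_power_exact_add:
  assumes "\<And>m. \<alpha> + real m + 1 \<noteq> 0" "\<And>m. \<beta> + real m + 1 \<noteq> 0"
  shows "fd.exact (jw \<alpha> \<beta>) (jp ^ n - cst (\<Prod>m<l. beta_ratio \<alpha> \<beta> (n + m)) * jp ^ (n + l))"
proof (induction l)
  case (Suc l)
  define C where "C = (\<Prod>m<l. beta_ratio \<alpha> \<beta> (n + m))"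
  have "fd.exact (jw \<alpha> \<beta>) (cst C * (jp ^ (n + l) - cst (beta_ratio \<alpha> \<beta> (n + l)) * jp ^ Suc (n + l)))"
    by (rule fd.exact_cmult) 
      (use jp_power_exact[OF assms(1)[of "n + l"] assms(2)[of "n + l"]] in \<open>simp_all add: beta_ratio_def\<close>)
  from fd.exact_add[OF Suc[folded C_def] this]
  have "fd.exact (jw \<alpha> \<beta>) (jp ^ n - cst (C * beta_ratio \<alpha> \<beta> (n + l)) * jp ^ (n + Suc l))"
    by (simp add: cst_mult algebra_simps)
  then show ?case by (simp only: C_def prod.lessThan_Suc)
qed simp

subsection \<open>Non-integer parameters\<close>

definition row_eigv :: "nat set \<Rightarrow> nat set \<Rightarrow> nat \<Rightarrow> real \<Rightarrow> real \<Rightarrow> nat \<Rightarrow> real" where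
  "row_eigv F1 F2 n \<alpha> \<beta> i = (if i < card F1 then eigv \<alpha> \<beta> (rdeg F1 F2 n i)
     else (real (rdeg F1 F2 n i) - \<beta>) * (real (rdeg F1 F2 n i) + \<alpha> + 1))"

lemma prod_sorted_list_of_set:
  fixes F :: "nat set"
  assumes "finite F"
  shows "(\<Prod>i<card F. h (sorted_list_of_set F ! i)) = (\<Prod>f\<in>F. h f)"
proof -
  have "bij_betw ((!) (sorted_list_of_set F)) {..<card F} F"
    using bij_betw_nth[of "sorted_list_of_set F" "{..<card F}" F] assms by simp
  then show ?thesis by (rule prod.reindex_bij_betw)
qed

text \<open>Every difference of eigenvalues splits into two linear factors, and these form the
  polynomial part of \<open>H_fun\<close>.\<close>

lemma prod_row_eigv:
  assumes "finite F1" "finite F2"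
  shows "(\<Prod>i<card F1 + card F2. eigv \<alpha> \<beta> n - row_eigv F1 F2 n \<alpha> \<beta> i) =
    (\<Prod>f\<in>F1. (real n - real f) * (real n + real f + \<alpha> + \<beta> + 1)) *
    (\<Prod>f\<in>F2. (real n + \<beta> - real f) * (real n + real f + \<alpha> + 1))"
proof -
  have "(\<Prod>i<card F1 + card F2. eigv \<alpha> \<beta> n - row_eigv F1 F2 n \<alpha> \<beta> i)
     = (\<Prod>i<card F1. eigv \<alpha> \<beta> n - row_eigv F1 F2 n \<alpha> \<beta> i) *
       (\<Prod>i<card F2. eigv \<alpha> \<beta> n - row_eigv F1 F2 n \<alpha> \<beta> (card F1 + i))"
  proof -
    have "(\<Prod>i<p + q. g i) = (\<Prod>i<p. g i) * (\<Prod>i<q. g (p + i))" for g :: "nat \<Rightarrow> real" and p q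
      by (induction q) (simp_all add: mult.assoc)
    then show ?thesis .
  qed
  also have "(\<Prod>i<card F1. eigv \<alpha> \<beta> n - row_eigv F1 F2 n \<alpha> \<beta> i)
      = (\<Prod>i<card F1. (\<lambda>f. (real n - real f) * (real n + real f + \<alpha> + \<beta> + 1)) (sorted_list_of_set F1 ! i))"
    by (rule prod.cong) (auto simp: row_eigv_def rdeg_def eigv_def algebra_simps)
  also have "(\<Prod>i<card F2. eigv \<alpha> \<beta> n - row_eigv F1 F2 n \<alpha> \<beta> (card F1 + i))
      = (\<Prod>i<card F2. (\<lambda>f. (real n + \<beta> - real f) * (real n + real f + \<alpha> + 1)) (sorted_list_of_set F2 ! i))"
    by (rule prod.cong) (auto simp: row_eigv_def rdeg_def eigv_def algebra_simps)
  finally show ?thesis 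
    unfolding prod_sorted_list_of_set[OF assms(1), where h = "\<lambda>f. (real n - real f) * (real n + real f + \<alpha> + \<beta> + 1)"]
      prod_sorted_list_of_set[OF assms(2), where h = "\<lambda>f. (real n + \<beta> - real f) * (real n + real f + \<alpha> + 1)"] .
qed

lemma pochhammer_double:
  "(\<Prod>m<l. (x + 2 * real m) * (x + 2 * real m + 1)) = pochhammer x (2 * l)"
proof (induction l)
  case (Suc l)
  have "2 * Suc l = Suc (Suc (2 * l))" by simp
  then show ?case using Suc by (simp add: pochhammer_Suc algebra_simps)
qed simp

text \<open>Up to a positive factor, the Gamma quotient is the norm of the \<open>n\<close>-th Jacobi polynomial,
  continued analytically in the parameters.\<close>

lemma Gamma_quotient_sign:
  assumes \<alpha>: "\<alpha> \<notin> \<int>" and \<beta>: "\<beta> \<notin> \<int>" and s: "not_neg_int (\<alpha> + \<beta>)"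
    and l: "\<alpha> + real n + real l + 1 > 0" "\<beta> + real n + real l + 1 > 0"
      "\<alpha> + \<beta> + 2 * real n + 2 * real l + 2 > 0"
  shows "\<exists>P>0. Gamma (real n + \<alpha> + 1) * Gamma (real n + \<beta> + 1) /
       ((2 * real n + \<alpha> + \<beta> + 1) * Gamma (real n + \<alpha> + \<beta> + 1)) =
     P * ((\<Prod>m<l. beta_ratio \<alpha> \<beta> (n + m)) / (\<Prod>j<n. eigv \<alpha> \<beta> n - eigv \<alpha> \<beta> j))"
    and "(\<Prod>j<n. eigv \<alpha> \<beta> n - eigv \<alpha> \<beta> j) \<noteq> 0"
proof -
  define a b \<gamma> where "a = real n + \<alpha> + 1" and "b = real n + \<beta> + 1" and "\<gamma> = real n + \<alpha> + \<beta> + 1"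
  have ab: "a \<notin> \<int>\<^sub>\<le>\<^sub>0" "b \<notin> \<int>\<^sub>\<le>\<^sub>0"
  proof -
    have "a - (real n + 1) = \<alpha>" "b - (real n + 1) = \<beta>" by (simp_all add: a_def b_def)
    moreover have "real n + 1 \<in> \<int>" by auto
    ultimately have "a \<notin> \<int>" "b \<notin> \<int>" using \<alpha> \<beta> Ints_diff by metis+
    then show "a \<notin> \<int>\<^sub>\<le>\<^sub>0" "b \<notin> \<int>\<^sub>\<le>\<^sub>0" using nonpos_Ints_Int by blast+
  qed
  have g: "\<gamma> + real m \<noteq> 0" for m
  proof
    assume "\<gamma> + real m = 0"
    then have "\<alpha> + \<beta> = - real (Suc (n + m))" by (simp add: \<gamma>_def)
    then show False using s unfolding not_neg_int_def by blast
  qed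
  have gZ: "\<gamma> + real m \<notin> \<int>\<^sub>\<le>\<^sub>0" for m
  proof
    assume "\<gamma> + real m \<in> \<int>\<^sub>\<le>\<^sub>0"
    then obtain i where "\<gamma> + real m = - real i" by (auto elim!: nonpos_Ints_cases')
    then show False using g[of "m + i"] by simp
  qed
  have pa: "pochhammer a l = Gamma (a + real l) / Gamma a" and pb: "pochhammer b l = Gamma (b + real l) / Gamma b"
    using ab by (simp_all add: pochhammer_Gamma)
  have pg: "pochhammer \<gamma> n = Gamma (\<gamma> + real n) / Gamma \<gamma>"
    using pochhammer_Gamma[OF gZ[of 0, simplified]] by simp
  have p2: "pochhammer (\<gamma> + real (n + 1)) (2 * l) = Gamma (\<gamma> + real (n + 1) + real (2 * l)) / Gamma (\<gamma> + real (n + 1))"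
    by (rule pochhammer_Gamma[OF gZ])
  have G1: "Gamma (\<gamma> + real (n + 1)) = (\<gamma> + real n) * Gamma (\<gamma> + real n)"
    using Gamma_plus1[OF gZ[of n]] by (simp add: add_ac)
  have nz: "Gamma a \<noteq> 0" "Gamma b \<noteq> 0" "Gamma \<gamma> \<noteq> 0" "Gamma (\<gamma> + real n) \<noteq> 0" "\<gamma> + real n \<noteq> 0"
    using ab gZ[of 0] gZ[of n] g[of n] by (simp_all add: Gamma_eq_zero_iff)
  define GA GB GC where "GA = Gamma (a + real l)" and "GB = Gamma (b + real l)"
    and "GC = Gamma (\<gamma> + real (n + 1) + real (2 * l))"
  have pos: "GA > 0" "GB > 0" "GC > 0"
    unfolding GA_def GB_def GC_def using l
    by (auto intro!: Gamma_real_pos simp: a_def b_def \<gamma>_def)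
  define Pr where "Pr = (\<Prod>j<n. eigv \<alpha> \<beta> n - eigv \<alpha> \<beta> j)"
  have Pr: "Pr = fact n * pochhammer \<gamma> n"
  proof -
    have "Pr = (\<Prod>j = 0..<n. (real n - real j) * (\<gamma> + real j))"
      unfolding Pr_def lessThan_atLeast0
      by (rule prod.cong) (auto simp: eigv_def \<gamma>_def algebra_simps)
    also have "\<dots> = (\<Prod>j = 0..<n. real n - real j) * pochhammer \<gamma> n"
      by (simp add: prod.distrib pochhammer_prod)
    also have "(\<Prod>j = 0..<n. real n - real j) = fact n * (real n gchoose n)"
      by (simp add: gbinomial_mult_fact)
    finally show ?thesis by (simp flip: binomial_gbinomial)
  qed
  have Pr0: "Pr \<noteq> 0" unfolding Pr pg using nz by simp
  then show "(\<Prod>j<n. eigv \<alpha> \<beta> n - eigv \<alpha> \<beta> j) \<noteq> 0" by (simp add: Pr_def)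
  define \<kappa> where "\<kappa> = (\<Prod>m<l. beta_ratio \<alpha> \<beta> (n + m))"
  have \<kappa>: "\<kappa> = pochhammer (\<gamma> + real (n + 1)) (2 * l) / (4 ^ l * pochhammer a l * pochhammer b l)"
  proof -
    have "\<kappa> = (\<Prod>m<l. ((\<gamma> + real (n + 1) + 2 * real m) * (\<gamma> + real (n + 1) + 2 * real m + 1))
        / (4 * (a + real m) * (b + real m)))"
      unfolding \<kappa>_def by (rule prod.cong) (auto simp: beta_ratio_def \<gamma>_def a_def b_def algebra_simps)
    then show ?thesis
      unfolding prod_dividef pochhammer_double unfolding prod.distrib
      by (simp only: pochhammer_prod[of a] pochhammer_prod[of b] lessThan_atLeast0 prod_constant
          card_atLeastLessThan diff_zero)
  qed
  \<comment> \<open>The Gamma values here have positive arguments, and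
    \<open>pochhammer \<gamma> n\<close>, whose sign is unknown, enters as a square.\<close>
  define P where "P = GA * GB * 4 ^ l * (pochhammer \<gamma> n)\<^sup>2 * fact n / GC"
  have "P > 0" unfolding P_def using pos Pr0 Pr by simp
  moreover have "Gamma a * Gamma b / ((\<gamma> + real n) * Gamma \<gamma>) = P * (\<kappa> / Pr)"
  proof -
    define t where "t = \<gamma> + real n"
    show ?thesis
      unfolding P_def \<kappa> Pr p2 pa pb pg G1 GA_def[symmetric] GB_def[symmetric] GC_def[symmetric] t_def[symmetric]
      using nz[folded t_def] pos by (simp add: field_simps power2_eq_square)
  qed
  moreover have "2 * real n + \<alpha> + \<beta> + 1 = \<gamma> + real n" by (simp add: \<gamma>_def)
  ultimately have "P > 0 \<and> Gamma a * Gamma b / ((2 * real n + \<alpha> + \<beta> + 1) * Gamma \<gamma>) = P * (\<kappa> / Pr)"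
    by (simp only:)
  then show "\<exists>P>0. Gamma (real n + \<alpha> + 1) * Gamma (real n + \<beta> + 1) /
       ((2 * real n + \<alpha> + \<beta> + 1) * Gamma (real n + \<alpha> + \<beta> + 1)) =
     P * ((\<Prod>m<l. beta_ratio \<alpha> \<beta> (n + m)) / (\<Prod>j<n. eigv \<alpha> \<beta> n - eigv \<alpha> \<beta> j))"
    unfolding a_def[symmetric] b_def[symmetric] \<gamma>_def[symmetric] \<kappa>_def[symmetric] Pr_def[symmetric] by blast
qed

lemma jc_top_nonzero:
  assumes "not_neg_int (\<alpha> + \<beta>)"
  shows "jc \<alpha> \<beta> n n \<noteq> 0"
proof -
  have "2 * real n + \<alpha> + \<beta> - real i \<noteq> 0" if "i < n" for i
  proof
    assume "2 * real n + \<alpha> + \<beta> - real i = 0"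
    then have "\<alpha> + \<beta> = - real (Suc (2 * n - i - 1))" using that by (simp add: of_nat_diff)
    then show False using assms by (auto simp: not_neg_int_def)
  qed
  then have "fact n * ((2 * real n + \<alpha> + \<beta>) gchoose n) \<noteq> 0"
    unfolding gbinomial_mult_fact by simp
  then show ?thesis by (simp add: jc_top)
qed

text \<open>By the Wronskian factorization, \<open>D = ext / ((1 + x)\<^bsup>k\<^sub>2\<^esup> red)\<close>, where \<open>ext\<close> is the
  exceptional polynomial of index \<open>n\<close> and \<open>red\<close> is \<open>\<Omega>\<close> up to sign.\<close>

lemma H_fun_nonneg_generic:
  assumes fin: "finite F1" "finite F2"
    and \<alpha>: "\<alpha> \<notin> \<int>" and \<beta>: "\<beta> \<notin> \<int>" and s: "not_neg_int (\<alpha> + \<beta>)"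
    and N: "\<And>f. f \<in> F1 \<union> F2 \<Longrightarrow> f \<le> N" "n \<le> N"
    and a: "\<alpha> + real (card F1 + card F2) + 1 > 0"
    and b: "\<beta> + real (card F1) - real (card F2) + 1 > 0"
    and \<Omega>: "\<And>x. x \<in> {-1..1} \<Longrightarrow> poly (red_omega F1 F2 n N \<alpha> \<beta>) x \<noteq> 0"
  shows "H_fun \<alpha> \<beta> F1 F2 (real n) \<ge> 0"
proof -
  define k1 k2 k where k: "k1 = card F1" "k2 = card F2" "k = k1 + k2"
  define y where "y = to_fract Y"
  define c where "c i = cst (rexp F1 F2 \<beta> i) / y" for i
  define v where "v i = to_fract (trow (rexp F1 F2 \<beta> i) (rcoeff F1 F2 n \<alpha> \<beta> i) N 0)" for i
  define red ext where "red = red_omega F1 F2 n N \<alpha> \<beta>" and "ext = red_ext F1 F2 n N \<alpha> \<beta>"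
  define u where "u = to_fract (jacobi_poly \<alpha> \<beta> n)"
  have y: "y \<noteq> 0" by (simp add: y_def)
  have deg: "rdeg F1 F2 n i \<le> N" for i
  proof (cases "i < k")
    case True
    then show ?thesis using rdeg_mem[OF fin, of i n] N k by (cases "i < card F1") auto
  next
    case False
    then show ?thesis using N k by (simp add: rdeg_def)
  qed
  have vj: "v i = to_fract (jacobi_poly \<alpha> (rpar F1 F2 \<beta> i) (rdeg F1 F2 n i))" for i
    unfolding v_def rcoeff_def jacobi_poly_trow[OF deg] ..
  have ck: "c k = 0" "v k = u"
    unfolding vj u_def by (simp_all add: c_def rexp_def k rpar_def rdeg_def)
  have red0: "red \<noteq> 0" using \<Omega>[of 0] by (auto simp: red_def)
  have W: "Determinant.det (fd.wr_mat c v k) * y ^ tri k = y ^ (tri k1 + tri k2) * to_fract red"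
    using det_wr_trow[of "rexp F1 F2 \<beta>" "rcoeff F1 F2 n \<alpha> \<beta>" N k]
    unfolding k trow_det_omega to_fract_mult to_fract_power
    by (simp only: c_def[abs_def] v_def[abs_def] y_def red_def k)
  have W': "Determinant.det (fd.wr_mat c v (Suc k)) * y ^ tri (Suc k) = y ^ (tri (Suc k1) + tri k2) * to_fract ext"
    using det_wr_trow[of "rexp F1 F2 \<beta>" "rcoeff F1 F2 n \<alpha> \<beta>" N "Suc k"]
    unfolding k trow_det_ext to_fract_mult to_fract_power
    by (simp only: c_def[abs_def] v_def[abs_def] y_def ext_def k)
  \<comment> \<open>As \<open>red\<close> is nonzero, no transformed seed vanishes, so every Darboux
    factor is genuine.\<close>
  have "Determinant.det (fd.wr_mat c v k) * y ^ tri k \<noteq> 0" unfolding W using y red0 by simp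
  then have "Determinant.det (fd.wr_mat c v k) \<noteq> 0" by auto
  then have nz: "fd.dop (fd.sigs c v i) (c i) (v i) \<noteq> 0" if "i < k" for i
    using that unfolding fd.det_wr_mat by simp
  define D where "D = fd.dop (fd.sigs c v k) 0 u"
  \<comment> \<open>The new row adds \<open>k\<close> powers of \<open>y\<close> by column scaling;
    \<open>k1\<close> of them are absorbed by the larger exponent-0 class, which leaves
    \<open>k2\<close>.\<close>
  have Dext: "D * (to_fract red * y ^ k2) = to_fract ext"
  proof -
    have "Determinant.det (fd.wr_mat c v (Suc k)) = Determinant.det (fd.wr_mat c v k) * D"
      unfolding fd.det_wr_mat_Suc D_def ck ..
    then have "y ^ (tri (Suc k1) + tri k2) * to_fract ext
        = (Determinant.det (fd.wr_mat c v k) * y ^ tri k) * D * y ^ k"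
      unfolding W'[symmetric] by (simp add: tri_def power_add)
    also have "\<dots> = y ^ (tri (Suc k1) + tri k2) * (D * (to_fract red * y ^ k2))"
      unfolding W by (simp add: tri_def power_add k)
    finally have e: "y ^ (tri (Suc k1) + tri k2) * to_fract ext = \<dots>" .
    have "y ^ (tri (Suc k1) + tri k2) \<noteq> 0" using y by simp
    then show ?thesis using e mult_left_cancel by metis
  qed
  have eig: "fd.eigenfun jp (jr \<alpha> \<beta>) 0 (c i) (v i) (cst (row_eigv F1 F2 n \<alpha> \<beta> i))" if "i < k" for i
  proof (cases "i < k1")
    case True
    then show ?thesis unfolding vj c_def using jacobi_eigenfun[of \<alpha> \<beta>]
      by (simp add: rexp_def rpar_def row_eigv_def k)
  next
    case False
    then show ?thesis unfolding vj c_def y_def using jacobi_eigenfun_twisted[of \<alpha> \<beta>] that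
      by (simp add: rexp_def rpar_def row_eigv_def k)
  qed
  define \<Lambda> where "\<Lambda> = (\<Prod>i<k. eigv \<alpha> \<beta> n - row_eigv F1 F2 n \<alpha> \<beta> i)"
  have "fd.exact (jw \<alpha> \<beta>) (jp ^ k * D\<^sup>2
      - (\<Prod>i<k. cst (eigv \<alpha> \<beta> n) - cst (row_eigv F1 F2 n \<alpha> \<beta> i)) * u\<^sup>2)"
    unfolding D_def
    by (rule fd.crum_norm[OF jr_eq]) (use eig nz jacobi_eigenfun in \<open>simp_all add: u_def\<close>)
  then have ex1: "fd.exact (jw \<alpha> \<beta>) (jp ^ k * D\<^sup>2 - cst \<Lambda> * u\<^sup>2)"
    by (simp only: \<Lambda>_def cst_prod cst_diff)
  define q where "q = fact n * jc \<alpha> \<beta> n n"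
  have q: "q \<noteq> 0" using jc_top_nonzero[OF s] by (simp add: q_def)
  define Pr where "Pr = (\<Prod>j<n. eigv \<alpha> \<beta> n - eigv \<alpha> \<beta> j)"
  have ex2: "fd.exact (jw \<alpha> \<beta>) (jp ^ n * (cst q)\<^sup>2 - cst Pr * u\<^sup>2)"
    using jacobi_square_exact_pderiv[of n n \<alpha> \<beta>]
    unfolding jacobi_pderiv_top u_def q_def Pr_def cst_def[of "fact n * jc \<alpha> \<beta> n n"] by simp
  \<comment> \<open>A large \<open>l0\<close> makes the shifted Gamma arguments positive; adding
    \<open>k\<close> to it makes \<open>jp ^ k\<close> a common factor below.\<close>
  obtain l0 :: nat where l0: "real l0 > \<bar>\<alpha>\<bar> + \<bar>\<beta>\<bar>" using reals_Archimedean2 by blast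
  define l where "l = l0 + k"
  define m where "m = n + l0"
  define \<kappa> where "\<kappa> = (\<Prod>m<l. beta_ratio \<alpha> \<beta> (n + m))"
  have nlk: "n + l = k + m" by (simp add: l_def m_def)
  have ai: "\<alpha> + real i + 1 \<noteq> 0" and bi: "\<beta> + real i + 1 \<noteq> 0" for i
  proof -
    have "x + real i + 1 \<noteq> 0" if "x \<notin> \<int>" for x
    proof
      assume "x + real i + 1 = 0"
      then have "x = - real (Suc i)" by simp
      then show False using that by auto
    qed
    then show "\<alpha> + real i + 1 \<noteq> 0" "\<beta> + real i + 1 \<noteq> 0" using \<alpha> \<beta> by auto
  qed
  have ex3: "fd.exact (jw \<alpha> \<beta>) (jp ^ n - cst \<kappa> * jp ^ (k + m))"
    unfolding \<kappa>_def nlk[symmetric] by (rule jp_power_exact_add[OF ai bi])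
  obtain P where P: "P > 0" "Gamma (real n + \<alpha> + 1) * Gamma (real n + \<beta> + 1) /
       ((2 * real n + \<alpha> + \<beta> + 1) * Gamma (real n + \<alpha> + \<beta> + 1)) = P * (\<kappa> / Pr)"
    and Pr: "Pr \<noteq> 0"
    unfolding \<kappa>_def Pr_def
    using Gamma_quotient_sign[OF \<alpha> \<beta> s, of n l] l0 unfolding l_def by force
  \<comment> \<open>Eliminating \<open>u\<^sup>2\<close> and then \<open>jp ^ n\<close> from the
    three exact elements leaves this constant, which has the sign of \<open>H_fun\<close>.\<close>
  define C where "C = \<Lambda> / Pr * q\<^sup>2 * \<kappa>"
  have ex: "fd.exact (jw \<alpha> \<beta>) (jp ^ k * D\<^sup>2 - cst C * jp ^ (k + m))"
  proof -
    have 2: "fd.exact (jw \<alpha> \<beta>) (cst (- (\<Lambda> / Pr)) * (jp ^ n * (cst q)\<^sup>2 - cst Pr * u\<^sup>2))"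
      by (rule fd.exact_cmult[OF _ ex2]) simp
    have 3: "fd.exact (jw \<alpha> \<beta>) (cst (\<Lambda> / Pr * q\<^sup>2) * (jp ^ n - cst \<kappa> * jp ^ (k + m)))"
      by (rule fd.exact_cmult[OF _ ex3]) simp
    define t where "t = \<Lambda> / Pr"
    have "\<Lambda> = t * Pr" using Pr by (simp add: t_def)
    then have "(jp ^ k * D\<^sup>2 - cst \<Lambda> * u\<^sup>2)
       + cst (- (\<Lambda> / Pr)) * (jp ^ n * (cst q)\<^sup>2 - cst Pr * u\<^sup>2)
       + cst (\<Lambda> / Pr * q\<^sup>2) * (jp ^ n - cst \<kappa> * jp ^ (k + m))
       = jp ^ k * D\<^sup>2 - cst C * jp ^ (k + m)"
      unfolding C_def t_def[symmetric]
      by (simp add: cst_minus cst_mult power2_eq_square algebra_simps)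
    then show ?thesis using fd.exact_add[OF fd.exact_add[OF ex1 2] 3] by (simp only:)
  qed
  \<comment> \<open>Numerator after clearing the denominator of \<open>D\<close> squared: a square
    minus \<open>C\<close> times a function positive on the open interval.\<close>
  define M where "M = ext\<^sup>2 - smult C (Y ^ (m + 2 * k2) * Z ^ m * red\<^sup>2)"
  have "\<exists>x. -1 < x \<and> x < 1 \<and> poly M x = 0"
  proof (rule exact_imp_zero[OF \<alpha> \<beta> ex[unfolded jw_def]])
    define z where "z = to_fract Z"
    have jp: "jp = y * z" unfolding jp_def y_def z_def by (rule to_fract_mult)
    have "(jp ^ k * D\<^sup>2 - cst C * jp ^ (k + m)) * (y ^ (2 * k2) * (to_fract red)\<^sup>2)
        = z ^ k * y ^ k * ((D * (to_fract red * y ^ k2))\<^sup>2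
            - cst C * (y ^ (m + 2 * k2) * z ^ m * (to_fract red)\<^sup>2))"
      unfolding jp by (simp add: power_mult_distrib power_add power_mult power_even_eq algebra_simps)
    then show "(jp ^ k * D\<^sup>2 - cst C * jp ^ (k + m)) * to_fract (Y ^ (2 * k2) * red\<^sup>2)
        = to_fract (Z ^ k * Y ^ k * M)"
      unfolding Dext unfolding M_def y_def z_def
      by (simp only: to_fract_mult to_fract_power to_fract_diff to_fract_smult)
    show "poly (red\<^sup>2) x \<noteq> 0" if "x \<in> {-1..1}" for x
      using \<Omega>[OF that] by (simp add: red_def)
    show "\<alpha> + real k > -1" using a by (simp add: k)
    \<comment> \<open>Here \<open>k - 2 * k2 = k1 - k2\<close>, so the assumed inequalities on the
      parameters are exactly integrability at the two ends.\<close>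
    show "\<beta> + real k - real (2 * k2) > -1" using b by (simp add: k)
  qed
  then obtain x where x: "-1 < x" "x < 1" "poly M x = 0" by blast
  define w where "w = (1 + x) ^ (m + 2 * k2) * (1 - x) ^ m * (poly red x)\<^sup>2"
  have "(poly ext x)\<^sup>2 = C * w"
    using x(3) by (simp add: M_def w_def)
  moreover have "w > 0"
    using x(1,2) \<Omega>[of x] by (simp add: w_def red_def)
  ultimately have "C \<ge> 0"
    by (metis zero_le_power2 zero_le_mult_iff not_less less_le_not_le)
  moreover have "C = q\<^sup>2 * (\<Lambda> * (\<kappa> / Pr))" by (simp add: C_def)
  moreover have "q\<^sup>2 > 0" using q by simp
  ultimately have L: "\<Lambda> * (\<kappa> / Pr) \<ge> 0" by (simp only: zero_le_mult_iff) auto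
  have "H_fun \<alpha> \<beta> F1 F2 (real n) = \<Lambda> * (P * (\<kappa> / Pr))"
    unfolding H_fun_def P(2) \<Lambda>_def k prod_row_eigv[OF fin] by simp
  also have "\<dots> = P * (\<Lambda> * (\<kappa> / Pr))" by simp
  finally show ?thesis using mult_nonneg_nonneg[OF less_imp_le[OF P(1)] L] by (simp only:)
qed

subsection \<open>Perturbation of the parameters\<close>

lemma continuous_on_det:
  fixes f :: "nat \<Rightarrow> nat \<Rightarrow> 'b::topological_space \<Rightarrow> real"
  assumes "\<And>i j. continuous_on S (f i j)"
  shows "continuous_on S (\<lambda>x. Determinant.det (Matrix.mat K K (\<lambda>(i, j). f i j x)))"
proof -
  have p: "\<pi> i < K" if "\<pi> permutes {0..<K}" "i < K" for \<pi> i
    using that permutes_in_image[of \<pi> "{0..<K}" i] by simp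
  have "Determinant.det (Matrix.mat K K (\<lambda>(i, j). f i j x))
      = (\<Sum>\<pi> | \<pi> permutes {0..<K}. signof \<pi> * (\<Prod>i = 0..<K. f i (\<pi> i) x))" for x
    using p by (subst det_def'[of _ K]) (auto intro!: sum.cong)
  then show ?thesis using assms by (simp only:) (intro continuous_intros)
qed

lemma continuous_on_gbinomial [continuous_intros]:
  fixes f :: "'b::topological_space \<Rightarrow> real"
  assumes "continuous_on S f"
  shows "continuous_on S (\<lambda>x. f x gchoose k)"
  unfolding gbinomial_prod_rev using assms by (intro continuous_intros) auto

text \<open>The first component is the common shift of both parameters, the second the point of
  evaluation.\<close>

lemma continuous_on_red_omega:
  "continuous_on S (\<lambda>p. poly (red_omega F1 F2 n N (\<alpha> + fst p) (\<beta> + fst p)) (snd p))"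
proof -
  have c: "continuous_on S (\<lambda>p. rcoeff F1 F2 n (\<alpha> + fst p) (\<beta> + fst p) i m)" for i m and S :: "(real \<times> real) set"
    unfolding rcoeff_def rpar_def jc_def
    by (cases "m \<le> rdeg F1 F2 n i"; cases "i < card F1"; cases "i < card F1 + card F2")
       (simp_all, (intro continuous_intros; simp)+)
  have b: "continuous_on S (\<lambda>p. rexp F1 F2 (\<beta> + fst p) i)" for i and S :: "(real \<times> real) set"
    unfolding rexp_def by (cases "i < card F1"; cases "i < card F1 + card F2")
       (simp_all, (intro continuous_intros)+)
  show ?thesis
    unfolding red_omega_def trow_red_def poly_sum poly_smult poly_power gvd_def ffact_def
    using c b by (intro continuous_intros continuous_on_det) auto
qed

text \<open>Compactness: the absolute value has a positive minimum at shift 0, and by uniform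
  continuity small shifts change the values by less than this minimum.\<close>

lemma red_omega_nonzero_eventually:
  assumes nz: "\<And>x. x \<in> {-1..1} \<Longrightarrow> poly (red_omega F1 F2 n N \<alpha> \<beta>) x \<noteq> 0"
  shows "\<forall>\<^sub>F \<epsilon> in at_right 0. \<forall>x\<in>{-1..1}. poly (red_omega F1 F2 n N (\<alpha> + \<epsilon>) (\<beta> + \<epsilon>)) x \<noteq> 0"
proof -
  define f where "f p = poly (red_omega F1 F2 n N (\<alpha> + fst p) (\<beta> + fst p)) (snd p)" for p
  have cont: "continuous_on ({-1..1} \<times> {-1..1}) f"
    unfolding f_def by (rule continuous_on_red_omega)
  have "compact ({-1..1} \<times> {-1..1} :: (real \<times> real) set)" by (intro compact_Times) auto
  then have uc: "uniformly_continuous_on ({-1..1} \<times> {-1..1}) f"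
    using cont compact_uniformly_continuous by blast
  have f0: "f (0, x) = poly (red_omega F1 F2 n N \<alpha> \<beta>) x" for x by (simp add: f_def)
  have "continuous_on {-1..1} (\<lambda>x. \<bar>f (0, x)\<bar>)"
    unfolding f0 by (intro continuous_intros)
  then obtain x0 where x0: "x0 \<in> {-1..1}" "\<And>x. x \<in> {-1..1} \<Longrightarrow> \<bar>f (0, x0)\<bar> \<le> \<bar>f (0, x)\<bar>"
    using continuous_attains_inf[of "{-1..1::real}" "\<lambda>x. \<bar>f (0, x)\<bar>"] by auto
  have "\<bar>f (0, x0)\<bar> > 0" using nz[OF x0(1)] by (simp add: f0)
  then obtain \<delta> where \<delta>: "\<delta> > 0"
    "\<And>p p'. p \<in> {-1..1} \<times> {-1..1} \<Longrightarrow> p' \<in> {-1..1} \<times> {-1..1} \<Longrightarrow> dist p' p < \<delta> \<Longrightarrow>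
       dist (f p') (f p) < \<bar>f (0, x0)\<bar>"
    using uc unfolding uniformly_continuous_on_def by meson
  have "\<forall>\<^sub>F \<epsilon> in at_right 0. \<epsilon> \<in> {0<..<min \<delta> 1}"
    by (rule eventually_at_right_real) (use \<delta> in simp)
  then show ?thesis
  proof eventually_elim
    case (elim \<epsilon>)
    show ?case
    proof
      fix x :: real assume x: "x \<in> {-1..1}"
      have "dist (f (\<epsilon>, x)) (f (0, x)) < \<bar>f (0, x0)\<bar>"
        by (rule \<delta>(2)) (use elim x in \<open>auto simp: dist_Pair_Pair dist_real_def\<close>)
      then have "f (\<epsilon>, x) \<noteq> 0" using x0(2)[OF x] by (auto simp: dist_real_def)
      then show "poly (red_omega F1 F2 n N (\<alpha> + \<epsilon>) (\<beta> + \<epsilon>)) x \<noteq> 0" by (simp add: f_def)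
    qed
  qed
qed

text \<open>For small shifts \<open>a + \<epsilon>\<close> lies strictly between the floor of
  \<open>a\<close> and the next integer.\<close>

lemma eventually_not_Ints: "\<forall>\<^sub>F \<epsilon> in at_right 0. a + \<epsilon> \<notin> \<int>" for a :: real
proof -
  have "\<forall>\<^sub>F \<epsilon> in at_right 0. \<epsilon> \<in> {0<..<real_of_int \<lfloor>a\<rfloor> + 1 - a}"
    by (rule eventually_at_right_real) linarith
  then show ?thesis
  proof eventually_elim
    case (elim \<epsilon>)
    show ?case
    proof
      assume "a + \<epsilon> \<in> \<int>"
      then obtain i where i: "a + \<epsilon> = of_int i" by (auto elim: Ints_cases)
      have "\<epsilon> > 0" "\<epsilon> < real_of_int \<lfloor>a\<rfloor> + 1 - a" using elim by auto
      then have "real_of_int \<lfloor>a\<rfloor> < of_int i" "real_of_int i < of_int (\<lfloor>a\<rfloor> + 1)"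
        using i of_int_floor_le[of a] unfolding of_int_add of_int_1 by linarith+
      then have "\<lfloor>a\<rfloor> < i" "i < \<lfloor>a\<rfloor> + 1" by (simp_all only: of_int_less_iff)
      then show False by simp
    qed
  qed
qed

section \<open>Passage to the limit in \<open>H_fun\<close>\<close>

lemma not_neg_int_nonpos_Ints:
  assumes "not_neg_int a"
  shows "real n + a + 1 \<notin> \<int>\<^sub>\<le>\<^sub>0"
proof
  assume "real n + a + 1 \<in> \<int>\<^sub>\<le>\<^sub>0"
  then obtain i where "real n + a + 1 = - real i" by (auto elim!: nonpos_Ints_cases')
  then have "a = - real (Suc (n + i))" by simp
  then show False using assms unfolding not_neg_int_def by blast
qed

text \<open>The hypotheses keep the three Gamma arguments off the poles and the linear factor of the
  denominator away from 0.\<close>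

lemma tendsto_H_fun:
  assumes "not_neg_int \<alpha>" "not_neg_int \<beta>" "not_neg_int (\<alpha> + \<beta>)"
  shows "((\<lambda>\<epsilon>. H_fun (\<alpha> + \<epsilon>) (\<beta> + \<epsilon>) F1 F2 (real n)) \<longlongrightarrow> H_fun \<alpha> \<beta> F1 F2 (real n)) (at_right 0)"
proof -
  have a: "((\<lambda>\<epsilon>. \<alpha> + \<epsilon>) \<longlongrightarrow> \<alpha>) (at_right 0)" and b: "((\<lambda>\<epsilon>. \<beta> + \<epsilon>) \<longlongrightarrow> \<beta>) (at_right 0)"
    by (auto intro!: tendsto_eq_intros)
  have g: "real n + \<alpha> + 1 \<notin> \<int>\<^sub>\<le>\<^sub>0" "real n + \<beta> + 1 \<notin> \<int>\<^sub>\<le>\<^sub>0" "real n + \<alpha> + \<beta> + 1 \<notin> \<int>\<^sub>\<le>\<^sub>0"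
    using assms[THEN not_neg_int_nonpos_Ints, of n] by (simp_all add: add.assoc)
  have "2 * real n + \<alpha> + \<beta> + 1 \<noteq> 0"
  proof
    assume "2 * real n + \<alpha> + \<beta> + 1 = 0"
    then have "\<alpha> + \<beta> = - real (Suc (2 * n))" by simp
    then show False using assms(3) unfolding not_neg_int_def by blast
  qed
  then have "(2 * real n + \<alpha> + \<beta> + 1) * Gamma (real n + \<alpha> + \<beta> + 1) \<noteq> 0"
    using g(3) by (simp add: Gamma_eq_zero_iff)
  then show ?thesis
    unfolding H_fun_def using g by (intro tendsto_intros tendsto_Gamma a b) auto
qed

theorem theorem6p2:
  fixes \<alpha> \<beta> :: real and F1 F2 :: "nat set"
  assumes "finite F1" and "finite F2" and "0 \<notin> F1" and "0 \<notin> F2"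
    and "F1 \<union> F2 \<noteq> {}"
    and A1: "not_neg_int \<alpha>" "not_neg_int \<beta>" "not_neg_int (\<alpha> + \<beta>)"
    and A2: "F2 \<noteq> {} \<Longrightarrow> not_neg_int (\<alpha> - \<beta>) \<and> not_neg_int (\<beta> - real (Max F2) - 1)"
    and "\<alpha> + real (card F1 + card F2) + 1 > 0"
    and "\<beta> + real (card F1) - real (card F2) + 1 > 0"
    and "\<forall>x\<in>{-1..1}. poly (Omega_poly \<alpha> \<beta> F1 F2) x \<noteq> 0"
  shows "jacobi_admissible \<alpha> \<beta> F1 F2"
proof -
  define F where "F = F1 \<union> F2"
  have "H_fun \<alpha> \<beta> F1 F2 (real n) \<ge> 0" for n
  proof -
    \<comment> \<open>The common bound must cover the degree \<open>n\<close> of the appended row as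
      well, so it is chosen separately for each \<open>n\<close>.\<close>
    define N where "N = Max (insert n F)"
    have finF: "finite (insert n F)" using assms(1,2) by (simp add: F_def)
    have N: "f \<le> N" if "f \<in> F1 \<union> F2" for f
      unfolding N_def using that finF by (intro Max_ge) (auto simp: F_def)
    have nN: "n \<le> N"
      unfolding N_def using finF by (intro Max_ge) auto
    obtain \<sigma> where "\<sigma> \<noteq> 0" "Omega_poly \<alpha> \<beta> F1 F2 = smult \<sigma> (red_omega F1 F2 n N \<alpha> \<beta>)"
      using Omega_poly_conv[OF assms(1,2) N] by blast
    then have "poly (red_omega F1 F2 n N \<alpha> \<beta>) x \<noteq> 0" if "x \<in> {-1..1}" for x
      using assms(12) that by auto
    then have \<Omega>: "\<forall>\<^sub>F \<epsilon> in at_right 0. \<forall>x\<in>{-1..1}. poly (red_omega F1 F2 n N (\<alpha> + \<epsilon>) (\<beta> + \<epsilon>)) x \<noteq> 0"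
      by (rule red_omega_nonzero_eventually)
    \<comment> \<open>Both parameters move by \<epsilon>, so their sum moves by
      \<open>2 * \<epsilon>\<close>.\<close>
    have "((\<lambda>\<epsilon>::real. 2 * \<epsilon>) \<longlongrightarrow> 2 * 0) (at_right 0)"
      by (intro tendsto_intros)
    then have "filterlim (\<lambda>\<epsilon>::real. 2 * \<epsilon>) (at_right 0) (at_right 0)"
      by (auto simp: filterlim_at eventually_at_filter)
    then have s: "\<forall>\<^sub>F \<epsilon> in at_right 0. \<alpha> + \<beta> + 2 * \<epsilon> \<notin> \<int>"
      by (rule eventually_compose_filterlim[OF eventually_not_Ints])
    have pos: "\<forall>\<^sub>F \<epsilon> in at_right 0. \<epsilon> > (0::real)"
      by (simp add: eventually_at_filter)
    have "\<forall>\<^sub>F \<epsilon> in at_right 0. H_fun (\<alpha> + \<epsilon>) (\<beta> + \<epsilon>) F1 F2 (real n) \<ge> 0"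
      using \<Omega> s pos eventually_not_Ints[of \<alpha>] eventually_not_Ints[of \<beta>]
    proof eventually_elim
      case (elim \<epsilon>)
      have "\<alpha> + \<epsilon> + (\<beta> + \<epsilon>) \<notin> \<int>" using elim(2) by (simp add: algebra_simps)
      moreover have "- real (Suc m) \<in> \<int>" for m by auto
      ultimately have "not_neg_int (\<alpha> + \<epsilon> + (\<beta> + \<epsilon>))"
        unfolding not_neg_int_def by metis
      then show ?case
        by (rule H_fun_nonneg_generic[OF assms(1,2) elim(4,5) _ N nN])
           (use assms(10,11) elim(1,3) in auto)
    qed
    then show ?thesis
      by (rule tendsto_lowerbound[OF tendsto_H_fun[OF A1]]) simp
  qed
  then show ?thesis by (simp add: jacobi_admissible_def)
qed

end
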